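(* Let $\phi(x,t)=\frac1p t^p+\frac1q a(x)t^q$ with $1<p<q<\infty$ and $a:\mathbb{R}^n\to[0,\infty)$ measurable. Then the following assertions are equivalent: (a) $\phi\in\mathcal{A}$. (b) There exists $C>0$ such that for every $f\in L^\phi(\mathbb{R}^n)$ with $\|f\|_\phi\le1$ and for every cube $Q$ in $\mathbb{R}^n$, $$\int_Q\phi\left(x,\frac{1}{|Q|}\int_Q|f(y)|\,dy\right)dx\le C\int_Q\phi(x,|f(x)|)\,dx.$$ (c) There exists $C>0$ such that for every $f\in L^{\phi^*}(\mathbb{R}^n)$ with $\|f\|_{\phi^*}\le1$ and for every cube $Q$ in $\mathbb{R}^n$, $$\int_Q\phi^*\left(x,\frac{1}{|Q|}\int_Q|f(y)|\,dy\right)dx\le C\int_Q\phi^*(x,|f(x)|)\,dx.$$ In particular, if one of (a)–(c) is valid, then so are the others, with constants $[\phi]_{\mathcal{A}}$ or $C$ depending only on $p$, $q$, and the constant in the assumed statement.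
   Context: Cubes have sides parallel to the coordinate axes. The conjugate function is $\phi^*(x,s)=\sup_{t\ge0}(st-\phi(x,t))$ for $s\ge0$ (with value $+\infty$ at $s=+\infty$). For $\varphi\in\{\phi,\phi^*\}$ and measurable $f$ on $\mathbb{R}^n$, $\|f\|_\varphi=\inf\{\lambda>0:\int_{\mathbb{R}^n}\varphi(x,|f(x)|/\lambda)\,dx\le1\}$, and $L^\varphi(\mathbb{R}^n)$ is the space of measurable $f$ with $\|f\|_\varphi<\infty$. We write $\phi\in\mathcal{A}$ if $$[\phi]_{\mathcal{A}}:=\sup_Q\frac{\|\mathbf{1}_Q\|_\phi\|\mathbf{1}_Q\|_{\phi^*}}{|Q|}<\infty,$$ the supremum being over all cubes $Q\subset\mathbb{R}^n$, where $\mathbf{1}_Q$ is the indicator function of $Q$ and $|Q|$ its Lebesgue measure. *)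

theory Defs
  imports "HOL-Analysis.Analysis"
begin

text \<open>
  The constants in the theorem must not depend on the dimension, so the dimension has to be a
  number and not a type.  A point of $n$-dimensional space is an extensional function on
  \<open>{..<n}\<close>, and Lebesgue measure is the completion of the \<open>n\<close>-fold product of \<^const>\<open>lborel\<close>
  (\<^const>\<open>lborel\<close> on a Euclidean space is itself a copy of such a product over the basis).
\<close>

type_synonym point = "nat \<Rightarrow> real"

definition leb :: "nat \<Rightarrow> point measure" where
  "leb n = completion (\<Pi>\<^sub>M i\<in>{..<n}. lborel)"

definition cube :: "nat \<Rightarrow> point \<Rightarrow> real \<Rightarrow> point set" where
  "cube n c l = (\<Pi>\<^sub>E i\<in>{..<n}. {c i..c i + l})"

definition cubes :: "nat \<Rightarrow> point set set" where
  "cubes n = {cube n c l | c l. 0 < l}"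

lemma space_leb: "space (leb n) = (\<Pi>\<^sub>E i\<in>{..<n}. UNIV)"
  by (simp add: leb_def space_PiM)

lemma cube_sets_leb: "cube n c l \<in> sets (leb n)"
  unfolding leb_def cube_def by (intro sets_completionI_sets sets_PiM_I_finite) auto

lemma emeasure_cube:
  assumes "0 \<le> l"
  shows "emeasure (leb n) (cube n c l) = ennreal (l ^ n)"
proof -
  interpret product_sigma_finite "\<lambda>_::nat. lborel :: real measure"
    by standard
  have "cube n c l \<in> sets (\<Pi>\<^sub>M i\<in>{..<n}. lborel)"
    unfolding cube_def by (intro sets_PiM_I_finite) auto
  then have "emeasure (leb n) (cube n c l) = emeasure (\<Pi>\<^sub>M i\<in>{..<n}. lborel) (cube n c l)"
    by (simp add: leb_def)
  also have "\<dots> = (\<Prod>i<n. ennreal l)"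
    unfolding cube_def using assms by (subst emeasure_PiM) auto
  also have "\<dots> = ennreal (l ^ n)"
    using assms by (simp add: ennreal_power)
  finally show ?thesis .
qed

text \<open>
  The second argument and the values lie in $[0,\infty]$, because the mean of a function in the
  space of the conjugate function over a cube can be infinite.
\<close>

type_synonym phi_fun = "point \<Rightarrow> ennreal \<Rightarrow> ennreal"

definition double_phase :: "real \<Rightarrow> real \<Rightarrow> (point \<Rightarrow> real) \<Rightarrow> phi_fun" where
  "double_phase p q a x t =
     (if t = \<infinity> then \<infinity>
      else ennreal (1 / p * enn2real t powr p + 1 / q * a x * enn2real t powr q))"

text \<open>
  Subtraction on \<^typ>\<open>ennreal\<close> truncates at \<open>0\<close>.  This does not change the supremum when
  \<open>\<phi> x 0 = 0\<close>, since \<open>t = 0\<close> then contributes the value \<open>0\<close>.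
\<close>

definition conjugate :: "phi_fun \<Rightarrow> phi_fun" where
  "conjugate \<phi> x s = (if s = \<infinity> then \<infinity> else (SUP t\<in>{..<\<infinity>}. s * t - \<phi> x t))"

definition lux_norm :: "nat \<Rightarrow> phi_fun \<Rightarrow> (point \<Rightarrow> real) \<Rightarrow> ennreal" where
  "lux_norm n \<phi> f =
     Inf {ennreal r | r. 0 < r \<and> (\<integral>\<^sup>+x. \<phi> x (ennreal (\<bar>f x\<bar> / r)) \<partial>leb n) \<le> 1}"

definition L_space :: "nat \<Rightarrow> phi_fun \<Rightarrow> (point \<Rightarrow> real) set" where
  "L_space n \<phi> = {f \<in> borel_measurable (leb n). lux_norm n \<phi> f < \<infinity>}"

definition A_const :: "nat \<Rightarrow> phi_fun \<Rightarrow> ennreal" where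
  "A_const n \<phi> =
     (SUP Q\<in>cubes n. lux_norm n \<phi> (indicator Q) * lux_norm n (conjugate \<phi>) (indicator Q)
                       / emeasure (leb n) Q)"

definition class_A :: "nat \<Rightarrow> phi_fun set" where
  "class_A n = {\<phi>. A_const n \<phi> < \<infinity>}"

definition mean :: "nat \<Rightarrow> point set \<Rightarrow> (point \<Rightarrow> real) \<Rightarrow> ennreal" where
  "mean n Q f = (\<integral>\<^sup>+y\<in>Q. ennreal \<bar>f y\<bar> \<partial>leb n) / emeasure (leb n) Q"

definition modular_mean_bound :: "nat \<Rightarrow> phi_fun \<Rightarrow> real \<Rightarrow> bool" where
  "modular_mean_bound n \<phi> C \<longleftrightarrow>
     (\<forall>f\<in>L_space n \<phi>. lux_norm n \<phi> f \<le> 1 \<longrightarrow>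
        (\<forall>Q\<in>cubes n. (\<integral>\<^sup>+x\<in>Q. \<phi> x (mean n Q f) \<partial>leb n)
                      \<le> ennreal C * (\<integral>\<^sup>+x\<in>Q. \<phi> x (ennreal \<bar>f x\<bar>) \<partial>leb n)))"

end

theory Submission
  imports Defs
begin

text \<open>
  Write \<open>\<phi>\<^sup>*\<close> for the conjugate function.  By Young's inequality the class constant controls averaging
  in norm: if \<open>\<integral>\<^sub>Q \<phi>(x, \<bar>h\<bar>) \<le> 1\<close> and \<open>m\<close> is the mean of \<open>\<bar>h\<bar>\<close> on the cube \<open>Q\<close>, then
  \<open>\<integral>\<^sub>Q \<phi>(x, m / (8 A)) \<le> 1\<close>, and likewise for \<open>\<phi>\<^sup>*\<close> (\<open>mean_bound\<close>).  What has to be gained is the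
  passage from norms to modulars.

  For a function which is homogeneous of degree \<open>r\<close> in \<open>t\<close> this passage is free: divide \<open>h\<close> by the
  \<open>r\<close>-th root of its modular, apply the norm statement and multiply back.  A double phase function
  mixes two degrees, but the degree which goes wrong always belongs to the unweighted power, and for an
  unweighted power Jensen's inequality gives the modular inequality without any weight condition.

  For \<open>\<phi>\<close> it is \<open>\<phi>(x, m)\<close> that is split: the term \<open>m\<^sup>p / p\<close> is handled by Jensen.  If \<open>J \<le> 1\<close> is the
  modular of \<open>h\<close>, then \<open>h / J\<^bsup>1/q\<^esup>\<close> has modular at most one, because \<open>q\<close> is the larger exponent; so the
  norm statement at this scale bounds the integral of \<open>a(x) m\<^sup>q\<close> by a multiple of \<open>J\<close>
  (\<open>phi_modular_mean_bound_if_A_const\<close>).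

  For \<open>\<phi>\<^sup>*\<close> it is the function that is split.  Up to a constant,
  \<open>\<phi>\<^sup>*(x, s)\<close> is \<open>s T(x, s)\<close> with \<open>T(x, s) = min (s\<^bsup>1/(p-1)\<^esup>) ((s/a(x))\<^bsup>1/(q-1)\<^esup>)\<close> (\<open>conj_upper\<close>,
  \<open>conj_lower\<close>), so \<open>\<phi>\<^sup>*\<close> is the smaller of an unweighted power of exponent \<open>p' = p/(p-1)\<close> and a
  weighted power of the smaller exponent \<open>q' = q/(q-1)\<close>.  Cut \<open>h\<close> into the part where the first power
  is the smaller one and the rest.  Jensen treats the first part, and the second part scales with
  the exponent \<open>q'\<close> (\<open>conj_modular_mean_bound_if_A_const\<close>).

  Conversely, a modular inequality is tested on a function \<open>T\<close> that nearly attains equality in Young's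
  inequality against a constant \<open>s\<close>.  If the modular of the constant in the dual function exceeds one,
  then \<open>\<integral>\<^sub>Q s T\<close> exceeds one, and after normalisation the mean of \<open>T\<close> is
  \<open>1 / (2 s \<bar>Q\<bar>)\<close>; this links the norms of the indicator of \<open>Q\<close> in the two spaces
  (\<open>lux_norm_product_bound\<close>).

  All estimates are pointwise in \<open>x\<close> or concern one cube, and their constants involve only \<open>p\<close>, \<open>q\<close>
  and the given constant; the dimension never enters.
\<close>

section \<open>The double phase integrand and its conjugate at a point\<close>

text \<open>
  Here \<open>1 + 1 / (r - 1)\<close> is the conjugate exponent of \<open>r\<close>; this form splits off a factor \<open>y\<close>, as
  in \<open>s * conj_slope b s\<close> below.
\<close>
lemma young_powr:
  fixes r :: real
  assumes "1 < r" "0 \<le> x" "0 \<le> y"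
  shows "x * y \<le> 1 / r * x powr r + (1 - 1 / r) * y powr (1 + 1 / (r - 1))"
proof -
  have *: "1 + 1 / (r - 1) = r / (r - 1)" "1 - 1 / r = 1 / (r / (r - 1))"
    using assms(1) by (auto simp: field_simps)
  show ?thesis
    using Youngs_inequality[of r "r / (r - 1)" x y] assms unfolding *
    by (auto simp: field_simps)
qed

locale exponents = fixes p q :: real assumes p: "1 < p" and pq: "p < q"
begin

lemma q: "1 < q" using p pq by simp

text \<open>The double phase integrand at a point where the weight has the value \<open>b\<close>.\<close>
definition dp :: "real \<Rightarrow> real \<Rightarrow> real" where
  "dp b t = 1 / p * t powr p + 1 / q * b * t powr q"

text \<open>
  A substitute for the derivative of the conjugate function, which has no closed form.  The two
  arguments of the minimum are the points \<open>t\<close> at which the derivatives \<open>t powr (p - 1)\<close> and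
  \<open>b * t powr (q - 1)\<close> of the two terms of \<open>dp b\<close> reach \<open>s\<close>.  For \<open>b = 0\<close> the second point
  is infinite, whereas division by zero would give \<open>0\<close>.
\<close>
definition conj_slope :: "real \<Rightarrow> real \<Rightarrow> real" where
  "conj_slope b s = (if b = 0 then s powr (1 / (p - 1))
     else min (s powr (1 / (p - 1))) ((s / b) powr (1 / (q - 1))))"

lemma dp_nonneg: "0 \<le> b \<Longrightarrow> 0 \<le> dp b t"
  using p q by (auto simp: dp_def)

lemma dp_0: "dp b 0 = 0" by (simp add: dp_def)

lemma dp_mono: "0 \<le> b \<Longrightarrow> 0 \<le> s \<Longrightarrow> s \<le> t \<Longrightarrow> dp b s \<le> dp b t"
  using p q unfolding dp_def by (intro add_mono mult_left_mono powr_mono2) auto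

lemma dp_scale_down:
  assumes "0 \<le> b" "0 \<le> t" "0 \<le> c" "c \<le> 1"
  shows "dp b (c * t) \<le> c powr p * dp b t"
proof -
  have "c powr q \<le> c powr p" using assms p pq
    by (cases "c = 0") (auto intro!: powr_mono')
  then have "(c powr q) * (b * t powr q / q) \<le> (c powr p) * (b * t powr q / q)"
    using assms q by (intro mult_right_mono) auto
  then show ?thesis using assms
    by (simp add: dp_def powr_mult algebra_simps)
qed

lemma dp_scale_up:
  assumes "0 \<le> b" "0 \<le> t" "1 \<le> c"
  shows "dp b (c * t) \<le> c powr q * dp b t"
proof -
  have "c powr p \<le> c powr q" using assms p pq
    by (auto intro!: powr_mono)
  then have "(c powr p) * (t powr p / p) \<le> (c powr q) * (t powr p / p)"
    using assms p by (intro mult_right_mono) auto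
  then show ?thesis using assms
    by (simp add: dp_def powr_mult algebra_simps)
qed

lemma conj_slope_nonneg: "0 \<le> conj_slope b s"
  by (simp add: conj_slope_def)

lemma conj_slope_pos: "0 < s \<Longrightarrow> 0 \<le> b \<Longrightarrow> 0 < conj_slope b s"
  by (simp add: conj_slope_def)

lemma powr_slope:
  assumes "(1::real) < r" "0 \<le> s" shows "(s powr (1 / (r - 1))) powr r = s * s powr (1 / (r - 1))"
proof (cases "s = 0")
  case False
  have "(s powr (1 / (r - 1))) powr r = s powr (1 + 1 / (r - 1))"
    using assms by (simp add: powr_powr field_simps)
  then show ?thesis using assms False by (simp add: powr_add)
qed auto

text \<open>
  The assumption says that \<open>t powr (r - 1)\<close> is at most \<open>s\<close> at \<open>T\<close>.  For \<open>T = conj_slope b s\<close>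
  this applies to \<open>r = p\<close>, and to \<open>r = q\<close> with \<open>s / b\<close> in place of \<open>s\<close>.
\<close>
lemma slope_le_powr:
  assumes "(1::real) < r" "0 \<le> s" "0 \<le> T" "T \<le> s powr (1 / (r - 1))"
  shows "T powr r \<le> s * T"
proof (cases "T = 0")
  case False
  have "T powr (r - 1) \<le> (s powr (1 / (r - 1))) powr (r - 1)"
    using assms by (intro powr_mono2) auto
  also have "\<dots> = s" using assms by (simp add: powr_powr)
  finally have "T powr (r - 1) * T \<le> s * T" using assms by (intro mult_right_mono) auto
  moreover have "T powr (r - 1) * T = T powr r" using assms False
    by (simp add: powr_diff)
  ultimately show ?thesis by simp
qed auto

lemma dp_conj_slope:
  assumes "0 \<le> b" "0 \<le> s"
  shows "dp b (conj_slope b s) \<le> 2 * (s * conj_slope b s)"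
proof -
  let ?T = "conj_slope b s"
  have T: "0 \<le> ?T" by (rule conj_slope_nonneg)
  have 1: "?T powr p \<le> s * ?T"
    using p assms T by (intro slope_le_powr) (auto simp: conj_slope_def)
  have 2: "b * ?T powr q \<le> s * ?T"
  proof (cases "b = 0")
    case False
    then have "?T powr q \<le> s / b * ?T"
      using q assms T by (intro slope_le_powr) (auto simp: conj_slope_def)
    then have "b * ?T powr q \<le> b * (s / b * ?T)" using assms by (intro mult_left_mono) auto
    then show ?thesis using False by simp
  qed (use assms T in auto)
  have "1 / p * ?T powr p \<le> 1 * ?T powr p" "1 / q * (b * ?T powr q) \<le> 1 * (b * ?T powr q)"
    using p q assms by (intro mult_right_mono; simp)+
  then show ?thesis using 1 2 unfolding dp_def by (simp add: mult.assoc)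
qed

text \<open>
  Either term of \<open>dp b t\<close> alone already gives an upper bound for the conjugate, by Young's
  inequality, and \<open>s * conj_slope b s\<close> is the smaller of these bounds.
\<close>
lemma conjugate_upper:
  assumes "0 \<le> b" "0 \<le> s" "0 \<le> t"
  shows "s * t - dp b t \<le> s * conj_slope b s"
proof -
  have yp: "s * t - dp b t \<le> s * s powr (1 / (p - 1))"
  proof -
    have "t * s \<le> 1 / p * t powr p + (1 - 1 / p) * s powr (1 + 1 / (p - 1))"
      using assms p by (intro young_powr)
    also have "(1 - 1 / p) * s powr (1 + 1 / (p - 1)) \<le> 1 * s powr (1 + 1 / (p - 1))"
      using p by (intro mult_right_mono) auto
    finally have "t * s \<le> 1 / p * t powr p + s * s powr (1 / (p - 1))"
      using assms by (cases "s = 0") (simp_all add: powr_add)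
    moreover have "0 \<le> 1 / q * b * t powr q" using q assms by simp
    ultimately show ?thesis unfolding dp_def by (simp add: mult.commute)
  qed
  have yq: "s * t - dp b t \<le> s * (s / b) powr (1 / (q - 1))" if "b \<noteq> 0"
  proof -
    have b: "0 < b" using assms that by simp
    have "t * (s / b) \<le> 1 / q * t powr q + (1 - 1 / q) * (s / b) powr (1 + 1 / (q - 1))"
      using assms q b by (intro young_powr) auto
    also have "(1 - 1 / q) * (s / b) powr (1 + 1 / (q - 1)) \<le> 1 * (s / b) powr (1 + 1 / (q - 1))"
      using q by (intro mult_right_mono) auto
    finally have "t * (s / b) \<le> 1 / q * t powr q + (s / b) * (s / b) powr (1 / (q - 1))"
      using assms b by (cases "s = 0") (simp_all add: powr_add)
    then have "b * (t * (s / b)) \<le> b * (1 / q * t powr q + (s / b) * (s / b) powr (1 / (q - 1)))"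
      using b by (intro mult_left_mono) auto
    then have "t * s \<le> 1 / q * b * t powr q + s * (s / b) powr (1 / (q - 1))"
      using b by (simp add: distrib_left mult_ac)
    moreover have "0 \<le> 1 / p * t powr p" using p by simp
    ultimately show ?thesis unfolding dp_def by (simp add: mult.commute)
  qed
  show ?thesis using yp yq by (auto simp: conj_slope_def min_def)
qed

definition equiv_const :: real where "equiv_const = 2 * 4 powr (1 / (p - 1))"

lemma equiv_const_ge_1: "1 \<le> equiv_const"
proof -
  have "1 \<le> 4 powr (1 / (p - 1))" using p by (intro ge_one_powr_ge_zero) auto
  then show ?thesis by (simp add: equiv_const_def)
qed

text \<open>
  At \<open>conj_slope b s\<close> itself \<open>dp b\<close> may be as large as twice \<open>s * conj_slope b s\<close>.  Shrinking
  the point by a factor \<open>k\<close> divides the linear term by \<open>k\<close> and \<open>dp b\<close> by at least \<open>k powr p\<close>;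
  \<open>k powr (p - 1) = 4\<close> makes the linear term win by a factor of two.
\<close>
lemma conjugate_lower:
  assumes "0 \<le> b" "0 \<le> s"
  defines "t \<equiv> conj_slope b s / 4 powr (1 / (p - 1))"
  shows "s * conj_slope b s \<le> equiv_const * (s * t - dp b t)"
proof -
  define k :: real where "k = 4 powr (1 / (p - 1))"
  have k: "1 \<le> k" unfolding k_def using p by (intro ge_one_powr_ge_zero) auto
  have T: "0 \<le> conj_slope b s" by (rule conj_slope_nonneg)
  have kp: "k powr p = 4 * k"
    unfolding k_def using powr_slope[of p 4] p by simp
  have t: "t = (1 / k) * conj_slope b s" by (simp add: t_def k_def)
  have "dp b t \<le> (1 / k) powr p * dp b (conj_slope b s)"
    unfolding t using assms k T by (intro dp_scale_down) auto
  also have "\<dots> \<le> (1 / k) powr p * (2 * (s * conj_slope b s))"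
    using assms by (intro mult_left_mono dp_conj_slope) auto
  also have "(1 / k) powr p = 1 / (4 * k)" using k by (simp add: powr_divide kp)
  finally have "dp b t \<le> s * conj_slope b s / (2 * k)" by simp
  moreover have "s * t = s * conj_slope b s / k" by (simp add: t)
  ultimately have "s * conj_slope b s / (2 * k) \<le> s * t - dp b t" by simp
  then have "2 * k * (s * conj_slope b s / (2 * k)) \<le> 2 * k * (s * t - dp b t)"
    using k by (intro mult_left_mono) auto
  then show ?thesis using k by (simp add: equiv_const_def k_def)
qed

lemma powr_exp_mono:
  assumes "(1::real) \<le> c" shows "c powr (1 / (q - 1)) \<le> c powr (1 / (p - 1))"
  using assms p pq by (intro powr_mono) (auto simp: field_simps)

lemma conj_slope_scale_up:
  assumes "0 \<le> b" "0 \<le> s" "1 \<le> c"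
  shows "conj_slope b (c * s) \<le> c powr (1 / (p - 1)) * conj_slope b s"
proof -
  have "(c * s / b) powr (1 / (q - 1)) \<le> c powr (1 / (p - 1)) * (s / b) powr (1 / (q - 1))"
  proof -
    have "(c * s / b) powr (1 / (q - 1)) = c powr (1 / (q - 1)) * (s / b) powr (1 / (q - 1))"
      using assms by (simp add: powr_mult powr_divide)
    also have "\<dots> \<le> c powr (1 / (p - 1)) * (s / b) powr (1 / (q - 1))"
      using assms by (intro mult_right_mono powr_exp_mono) auto
    finally show ?thesis .
  qed
  then show ?thesis using assms
    by (auto simp: conj_slope_def powr_mult min_mult_distrib_left intro: min.mono)
qed

lemma conj_slope_scale_down:
  assumes "0 \<le> b" "0 \<le> s" "0 < c" "c \<le> 1"
  shows "conj_slope b (c * s) \<le> c powr (1 / (q - 1)) * conj_slope b s"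
proof -
  have "c powr (1 / (p - 1)) \<le> c powr (1 / (q - 1))"
    using assms p pq by (intro powr_mono') (auto simp: field_simps)
  then have "c powr (1 / (p - 1)) * s powr (1 / (p - 1)) \<le> c powr (1 / (q - 1)) * s powr (1 / (p - 1))"
    by (intro mult_right_mono) auto
  moreover have "(c * s / b) powr (1 / (q - 1)) = c powr (1 / (q - 1)) * (s / b) powr (1 / (q - 1))"
    using assms by (simp add: powr_mult powr_divide)
  ultimately show ?thesis using assms
    by (auto simp: conj_slope_def powr_mult min_mult_distrib_left intro: min.mono)
qed

text \<open>
  Where the weighted power is active, it stays an upper bound at every other scale.  So growth with
  the better exponent \<open>1 / (q - 1)\<close> also holds for \<open>c > 1\<close>, where in general only \<open>1 / (p - 1)\<close> is
  true.
\<close>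
lemma conj_slope_scale_up_weighted:
  assumes "0 \<le> b" "0 \<le> s" "0 < c" "conj_slope b s \<noteq> s powr (1 / (p - 1))"
  shows "conj_slope b (c * s) \<le> c powr (1 / (q - 1)) * conj_slope b s"
proof -
  have b: "b \<noteq> 0" and T: "conj_slope b s = (s / b) powr (1 / (q - 1))"
    using assms(4) by (auto simp: conj_slope_def min_def split: if_splits)
  have "conj_slope b (c * s) \<le> (c * s / b) powr (1 / (q - 1))"
    using b by (simp add: conj_slope_def)
  then show ?thesis using assms unfolding T by (simp add: powr_mult powr_divide)
qed

text \<open>
  The derivative of \<open>dp b\<close> at \<open>s\<close> plays for the conjugate function the part that \<open>conj_slope\<close>
  plays for \<open>dp\<close>: its conjugate value is at most \<open>s\<close> times itself.
\<close>
lemma slope_young: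
  assumes "0 \<le> b" "0 \<le> s" "0 \<le> u"
  shows "(s powr (p - 1) + b * s powr (q - 1)) * u - dp b u \<le> s * (s powr (p - 1) + b * s powr (q - 1))"
proof -
  have *: "s powr (r - 1) * u \<le> 1 / r * u powr r + s * s powr (r - 1)" if r: "1 < r" for r
  proof -
    have e: "(r - 1) * (1 + 1 / (r - 1)) = r" using r by (simp add: field_simps)
    have "u * s powr (r - 1) \<le> 1 / r * u powr r + (1 - 1 / r) * (s powr (r - 1)) powr (1 + 1 / (r - 1))"
      using r assms by (intro young_powr) auto
    also have "(s powr (r - 1)) powr (1 + 1 / (r - 1)) = s * s powr (r - 1)"
      unfolding powr_powr e using assms r by (cases "s = 0") (simp_all add: powr_diff)
    also have "(1 - 1 / r) * (s * s powr (r - 1)) \<le> 1 * (s * s powr (r - 1))"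
      using r assms by (intro mult_right_mono) auto
    finally show ?thesis by (simp add: mult.commute)
  qed
  have "b * (s powr (q - 1) * u) \<le> b * (1 / q * u powr q + s * s powr (q - 1))"
    using * q assms by (intro mult_left_mono) auto
  then show ?thesis using *[OF p] by (simp add: dp_def algebra_simps)
qed

text \<open>
  The constants in the modular inequalities for a class constant \<open>A\<close>.  The first factor
  of each is the doubling constant of the integrand, which in \<open>K_conj\<close> occurs a second time because
  the mean of a function is compared with the means of two parts.
\<close>
definition K_phi :: "real \<Rightarrow> real" where
  "K_phi A = 2 powr q * (1 + (8 * A) powr q)"

definition K_conj :: "real \<Rightarrow> real" where
  "K_conj A = (equiv_const * 2 powr (1 + 1 / (p - 1))) * ((equiv_const * 2 powr (1 + 1 / (p - 1))) *
     (equiv_const + equiv_const * equiv_const * (8 * A * equiv_const) powr (1 + 1 / (p - 1))))"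

end

section \<open>Means, modulars and pairs in Young duality\<close>

lemma cubes_emeasure:
  assumes "Q \<in> cubes n"
  obtains v where "Q \<in> sets (leb n)" "0 < v" "emeasure (leb n) Q = ennreal v"
proof -
  obtain c l where "Q = cube n c l" "0 < l" using assms by (auto simp: cubes_def)
  then show ?thesis
    using that[of "l ^ n"] cube_sets_leb[of n c l] emeasure_cube[of l n c] by simp
qed

text \<open>
  For rescaling by a root of the modular \<open>I\<close>, where \<open>I\<close> may be zero: a bound by every positive
  real upper bound \<open>J \<le> 1\<close> of \<open>I\<close> suffices.
\<close>
lemma ennreal_le_of_scaled_bounds:
  fixes L I :: ennreal
  assumes "I \<le> 1" "0 \<le> K" and J: "\<And>J. 0 < J \<Longrightarrow> J \<le> 1 \<Longrightarrow> I \<le> ennreal J \<Longrightarrow> L \<le> ennreal K * ennreal J"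
  shows "L \<le> ennreal K * I"
proof (cases "I = 0")
  case True
  have small: "L \<le> 0 + ennreal e" if e: "0 < e" for e :: real
  proof -
    define J where "J = min 1 (e / (K + 1))"
    have J0: "0 < J" "J \<le> 1" using e assms(2) by (auto simp: J_def)
    have "L \<le> ennreal (K * J)" using J[of J] J0 assms(2) True by (simp add: ennreal_mult')
    also have "K * J \<le> (K + 1) * (e / (K + 1))"
      using J0 assms(2) by (intro mult_mono) (auto simp: J_def)
    also have "\<dots> = e" using assms(2) by simp
    finally show ?thesis using assms(2) by (simp add: ennreal_leI)
  qed
  have "L \<le> 0" by (rule ennreal_le_epsilon) (rule small)
  then show ?thesis by simp
next
  case False
  then obtain i where i: "I = ennreal i" "0 \<le> i"
    using assms(1) by (cases I) (auto simp: top_unique)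
  with False assms(1) have "0 < i" "i \<le> 1" by (auto simp: order_le_less)
  then show ?thesis using J[of i] i by simp
qed

lemma ennreal_mult_le_if_less:
  fixes a b c :: ennreal
  assumes "\<And>y. y < b \<Longrightarrow> a * y \<le> c"
  shows "a * b \<le> c"
proof -
  have b: "(SUP y\<in>{y. y < b}. y) = b"
  proof (rule antisym)
    show "(SUP y\<in>{y. y < b}. y) \<le> b" by (rule SUP_least) simp
    show "b \<le> (SUP y\<in>{y. y < b}. y)" by (rule dense_le) (rule SUP_upper, simp)
  qed
  have "a * (SUP y\<in>{y. y < b}. y) = (SUP y\<in>{y. y < b}. a * y)"
    by (rule SUP_mult_left_ennreal)
  also have "\<dots> \<le> c" using assms by (intro SUP_least) simp
  finally show ?thesis unfolding b .
qed

lemma mean_cmult: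
  assumes "f \<in> borel_measurable (leb n)" "Q \<in> sets (leb n)"
  shows "mean n Q (\<lambda>x. c * f x) = ennreal \<bar>c\<bar> * mean n Q f"
proof -
  have [measurable]: "f \<in> borel_measurable (leb n)" "Q \<in> sets (leb n)" by fact+
  have "(\<integral>\<^sup>+y\<in>Q. ennreal \<bar>c * f y\<bar> \<partial>leb n) = (\<integral>\<^sup>+y. ennreal \<bar>c\<bar> * (ennreal \<bar>f y\<bar> * indicator Q y) \<partial>leb n)"
    by (intro nn_integral_cong) (simp add: abs_mult ennreal_mult mult.assoc)
  also have "\<dots> = ennreal \<bar>c\<bar> * (\<integral>\<^sup>+y\<in>Q. ennreal \<bar>f y\<bar> \<partial>leb n)"
    by (intro nn_integral_cmult) measurable
  finally show ?thesis by (simp add: mean_def ennreal_times_divide)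
qed

lemma mean_add:
  assumes [measurable]: "f \<in> borel_measurable (leb n)" "g \<in> borel_measurable (leb n)" "Q \<in> sets (leb n)"
    and disj: "\<And>x. \<bar>h x\<bar> = \<bar>f x\<bar> + \<bar>g x\<bar>"
  shows "mean n Q h = mean n Q f + mean n Q g"
proof -
  have "(\<integral>\<^sup>+y\<in>Q. ennreal \<bar>h y\<bar> \<partial>leb n) = (\<integral>\<^sup>+y. ennreal \<bar>f y\<bar> * indicator Q y + ennreal \<bar>g y\<bar> * indicator Q y \<partial>leb n)"
    by (intro nn_integral_cong) (simp add: disj indicator_def)
  also have "\<dots> = (\<integral>\<^sup>+y\<in>Q. ennreal \<bar>f y\<bar> \<partial>leb n) + (\<integral>\<^sup>+y\<in>Q. ennreal \<bar>g y\<bar> \<partial>leb n)"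
    by (intro nn_integral_add) measurable
  finally show ?thesis by (simp add: mean_def add_divide_distrib_ennreal)
qed

text \<open>
  Jensen's inequality for a power, by integrating the tangent line inequality at the mean, which is
  an instance of Young's inequality.
\<close>
lemma jensen_powr:
  assumes "f \<in> borel_measurable (leb n)" "Q \<in> sets (leb n)"
    and v: "0 < v" "emeasure (leb n) Q = ennreal v"
    and m: "mean n Q f = ennreal m" "0 \<le> m" and r: "1 < r"
  shows "ennreal (m powr r) * ennreal v \<le> (\<integral>\<^sup>+x\<in>Q. ennreal (\<bar>f x\<bar> powr r) \<partial>leb n)"
    (is "_ \<le> ?I")
proof (cases "?I = \<infinity>")
  case False
  have [measurable]: "f \<in> borel_measurable (leb n)" "Q \<in> sets (leb n)" by fact+
  from False obtain i where i: "?I = ennreal i" "0 \<le> i"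
    by (cases ?I) (auto simp: infinity_ennreal_def)
  have int: "(\<integral>\<^sup>+y\<in>Q. ennreal \<bar>f y\<bar> \<partial>leb n) = ennreal (m * v)"
  proof -
    have "ennreal m * ennreal v = (\<integral>\<^sup>+y\<in>Q. ennreal \<bar>f y\<bar> \<partial>leb n) / ennreal v * ennreal v"
      using m v by (simp add: mean_def)
    also have "\<dots> = (\<integral>\<^sup>+y\<in>Q. ennreal \<bar>f y\<bar> \<partial>leb n)"
      using v by (simp add: ennreal_divide_times)
    finally show ?thesis using m v by (simp add: ennreal_mult)
  qed
  define M where "M = m powr (r - 1)"
  have M: "0 \<le> M" by (simp add: M_def)
  have Mr: "M powr (1 + 1 / (r - 1)) = m powr r" "M * m = m powr r"
  proof -
    have e: "(r - 1) * (1 + 1 / (r - 1)) = r" using r by (simp add: field_simps)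
    show "M powr (1 + 1 / (r - 1)) = m powr r"
      unfolding M_def powr_powr e ..
    show "M * m = m powr r" using m r
      by (cases "m = 0") (simp_all add: M_def powr_diff)
  qed
  have pt: "r * M * \<bar>y\<bar> \<le> \<bar>y\<bar> powr r + (r - 1) * m powr r" for y :: real
  proof -
    have "\<bar>y\<bar> * M \<le> 1 / r * \<bar>y\<bar> powr r + (1 - 1 / r) * m powr r"
      using young_powr[OF r, of "\<bar>y\<bar>" M] M Mr by simp
    then have "r * (\<bar>y\<bar> * M) \<le> r * (1 / r * \<bar>y\<bar> powr r + (1 - 1 / r) * m powr r)"
      using r by (intro mult_left_mono) auto
    then show ?thesis using r by (simp add: algebra_simps)
  qed
  have "ennreal (r * M) * ennreal (m * v) = (\<integral>\<^sup>+y. ennreal (r * M) * (ennreal \<bar>f y\<bar> * indicator Q y) \<partial>leb n)"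
    unfolding int[symmetric] by (subst nn_integral_cmult) auto
  also have "\<dots> \<le> (\<integral>\<^sup>+y. ennreal (\<bar>f y\<bar> powr r) * indicator Q y + ennreal ((r - 1) * m powr r) * indicator Q y \<partial>leb n)"
  proof (intro nn_integral_mono)
    fix y
    have "ennreal (r * M) * ennreal \<bar>f y\<bar> \<le> ennreal (\<bar>f y\<bar> powr r) + ennreal ((r - 1) * m powr r)"
      using pt[of "f y"] r M
      by (simp add: ennreal_mult[symmetric] ennreal_plus[symmetric] ennreal_leI del: ennreal_plus)
    then show "ennreal (r * M) * (ennreal \<bar>f y\<bar> * indicator Q y) \<le>
        ennreal (\<bar>f y\<bar> powr r) * indicator Q y + ennreal ((r - 1) * m powr r) * indicator Q y"
      by (auto simp: indicator_def)
  qed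
  also have "\<dots> = ennreal i + ennreal ((r - 1) * m powr r) * ennreal v"
    using v i by (subst nn_integral_add) (auto simp: nn_integral_cmult_indicator)
  finally have "ennreal (r * M * (m * v)) \<le> ennreal (i + (r - 1) * m powr r * v)"
    using r M m v i by (simp add: ennreal_mult[symmetric] ennreal_plus[symmetric] del: ennreal_plus)
  then have "r * M * (m * v) \<le> i + (r - 1) * m powr r * v"
    using r v i by (subst (asm) ennreal_le_iff) auto
  moreover have "r * M * (m * v) = r * (m powr r * v)" using Mr(2) by (simp add: mult_ac)
  moreover have "(r - 1) * m powr r * v = r * (m powr r * v) - m powr r * v"
    by (simp add: algebra_simps)
  ultimately have "m powr r * v \<le> i" by linarith
  then show ?thesis using i v by (simp add: ennreal_mult[symmetric] ennreal_leI)
qed simp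

text \<open>
  The properties shared by \<open>\<phi>\<close> and its conjugate that allow each to stand on either side of the
  duality.  The inequality \<open>scale\<close> is what remains of convexity.
\<close>
locale modular_fun =
  fixes n :: nat and \<Phi> :: phi_fun
  assumes zero: "x \<in> space (leb n) \<Longrightarrow> \<Phi> x 0 = 0"
    and mono: "x \<in> space (leb n) \<Longrightarrow> u \<le> w \<Longrightarrow> \<Phi> x u \<le> \<Phi> x w"
    and scale: "x \<in> space (leb n) \<Longrightarrow> 0 < c \<Longrightarrow> c \<le> 1 \<Longrightarrow> 0 \<le> t \<Longrightarrow>
      \<Phi> x (ennreal (c * t)) \<le> ennreal c * \<Phi> x (ennreal t)"
    and pos: "x \<in> space (leb n) \<Longrightarrow> 0 < \<Phi> x 1"
    and measurable_comp: "f \<in> borel_measurable (leb n) \<Longrightarrow>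
      (\<lambda>x. \<Phi> x (ennreal \<bar>f x\<bar>)) \<in> borel_measurable (leb n)"
begin

lemma measurable_const: "0 \<le> c \<Longrightarrow> (\<lambda>x. \<Phi> x (ennreal c)) \<in> borel_measurable (leb n)"
  using measurable_comp[of "\<lambda>_. c"] by simp

lemma set_integral_mono:
  assumes "Q \<in> sets (leb n)" "s \<le> t"
  shows "(\<integral>\<^sup>+x\<in>Q. \<Phi> x s \<partial>leb n) \<le> (\<integral>\<^sup>+x\<in>Q. \<Phi> x t \<partial>leb n)"
  using assms mono by (intro nn_integral_mono mult_right_mono) auto

lemma integral_indicator:
  assumes "0 < r"
  shows "(\<integral>\<^sup>+x. \<Phi> x (ennreal (\<bar>indicator Q x\<bar> / r)) \<partial>leb n) = (\<integral>\<^sup>+x\<in>Q. \<Phi> x (ennreal (1 / r)) \<partial>leb n)"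
  using zero by (intro nn_integral_cong) (auto simp: indicator_def)

lemma lux_norm_indicator_le:
  assumes "0 < r" "(\<integral>\<^sup>+x\<in>Q. \<Phi> x (ennreal (1 / r)) \<partial>leb n) \<le> 1"
  shows "lux_norm n \<Phi> (indicator Q) \<le> ennreal r"
  unfolding lux_norm_def using assms integral_indicator[OF assms(1)] by (intro Inf_lower) auto

lemma integral_le_1_if_lux_norm_less:
  assumes "lux_norm n \<Phi> f < ennreal r"
  shows "(\<integral>\<^sup>+x. \<Phi> x (ennreal (\<bar>f x\<bar> / r)) \<partial>leb n) \<le> 1"
proof -
  obtain r' where r': "0 < r'" "(\<integral>\<^sup>+x. \<Phi> x (ennreal (\<bar>f x\<bar> / r')) \<partial>leb n) \<le> 1" "ennreal r' < ennreal r"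
    using assms unfolding lux_norm_def Inf_less_iff by auto
  then have "r' \<le> r" by (simp add: ennreal_less_iff)
  then have "(\<integral>\<^sup>+x. \<Phi> x (ennreal (\<bar>f x\<bar> / r)) \<partial>leb n) \<le> (\<integral>\<^sup>+x. \<Phi> x (ennreal (\<bar>f x\<bar> / r')) \<partial>leb n)"
    using r' by (intro nn_integral_mono mono ennreal_leI divide_left_mono) auto
  then show ?thesis using r'(2) by simp
qed

lemma indicator_integral_le_1_if_lux_norm_less:
  assumes "lux_norm n \<Phi> (indicator Q) < ennreal r" "0 < r"
  shows "(\<integral>\<^sup>+x\<in>Q. \<Phi> x (ennreal (1 / r)) \<partial>leb n) \<le> 1"
  using integral_le_1_if_lux_norm_less[OF assms(1)] integral_indicator[OF assms(2)] by simp

text \<open>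
  If the norm vanished, the constants \<open>1 / c\<close> would all have modular at most one, and by \<open>scale\<close>
  the modular of \<open>1\<close> would be at most every \<open>c > 0\<close>.  Positivity matters because a product
  \<open>0 * \<infinity>\<close> in the class constant would count as \<open>0\<close>.
\<close>
lemma lux_norm_indicator_pos:
  assumes Q: "Q \<in> cubes n"
  shows "0 < lux_norm n \<Phi> (indicator Q)"
proof (rule ccontr)
  assume "\<not> 0 < lux_norm n \<Phi> (indicator Q)"
  then have 0: "lux_norm n \<Phi> (indicator Q) = 0" by (simp add: zero_less_iff_neq_zero)
  obtain v where v: "Q \<in> sets (leb n)" "0 < v" "emeasure (leb n) Q = ennreal v"
    using cubes_emeasure[OF Q] .
  have [measurable]: "Q \<in> sets (leb n)" "(\<lambda>x. \<Phi> x 1) \<in> borel_measurable (leb n)"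
    using v measurable_const[of 1] by auto
  have small: "(\<integral>\<^sup>+x\<in>Q. \<Phi> x 1 \<partial>leb n) \<le> 0 + ennreal e" if e: "0 < e" for e :: real
  proof -
    define c where "c = min 1 e"
    have c: "0 < c" "c \<le> 1" "c \<le> e" using e by (auto simp: c_def)
    have "(\<integral>\<^sup>+x\<in>Q. \<Phi> x 1 \<partial>leb n) \<le> (\<integral>\<^sup>+x. ennreal c * (\<Phi> x (ennreal (1 / c)) * indicator Q x) \<partial>leb n)"
    proof (intro nn_integral_mono)
      fix x assume "x \<in> space (leb n)"
      then have "\<Phi> x 1 \<le> ennreal c * \<Phi> x (ennreal (1 / c))"
        using scale[of x c "1 / c"] c by simp
      then show "\<Phi> x 1 * indicator Q x \<le> ennreal c * (\<Phi> x (ennreal (1 / c)) * indicator Q x)"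
        by (auto simp: indicator_def)
    qed
    also have "\<dots> = ennreal c * (\<integral>\<^sup>+x\<in>Q. \<Phi> x (ennreal (1 / c)) \<partial>leb n)"
      using measurable_const[of "1 / c"] c by (intro nn_integral_cmult) auto
    also have "\<dots> \<le> ennreal c * 1"
      using c 0 by (intro mult_left_mono indicator_integral_le_1_if_lux_norm_less) auto
    also have "\<dots> \<le> ennreal e" using c by (simp add: ennreal_leI)
    finally show ?thesis by simp
  qed
  have "(\<integral>\<^sup>+x\<in>Q. \<Phi> x 1 \<partial>leb n) \<le> 0"
    by (rule ennreal_le_epsilon) (rule small)
  then have "(\<integral>\<^sup>+x\<in>Q. \<Phi> x 1 \<partial>leb n) = 0" by (simp only: le_zero_eq)
  then have "AE x in leb n. \<Phi> x 1 * indicator Q x = 0"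
    by (subst (asm) nn_integral_0_iff_AE) measurable
  with AE_space have "AE x in leb n. x \<notin> Q"
  proof eventually_elim
    case (elim x)
    then show ?case using pos[of x] by (auto simp: indicator_def)
  qed
  then have "emeasure (leb n) Q = 0"
    using v AE_iff_null_sets[of Q "leb n"] by auto
  then show False using v by simp
qed

lemma lux_norm_le_1:
  assumes "f \<in> borel_measurable (leb n)" "(\<integral>\<^sup>+x. \<Phi> x (ennreal \<bar>f x\<bar>) \<partial>leb n) \<le> 1"
  shows "f \<in> L_space n \<Phi>" "lux_norm n \<Phi> f \<le> 1"
proof -
  have "lux_norm n \<Phi> f \<le> ennreal 1"
    unfolding lux_norm_def using assms by (intro Inf_lower) (auto intro!: exI[of _ 1])
  then show "f \<in> L_space n \<Phi>" "lux_norm n \<Phi> f \<le> 1"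
    using assms by (auto simp: L_space_def intro: le_less_trans)
qed

end

locale young_pair = modular_fun n \<Phi> + dual: modular_fun n \<Psi> for n \<Phi> \<Psi> +
  assumes young: "x \<in> space (leb n) \<Longrightarrow> 0 \<le> s \<Longrightarrow> 0 \<le> t \<Longrightarrow>
    ennreal (s * t) \<le> \<Phi> x (ennreal s) + \<Psi> x (ennreal t)"
begin

text \<open>
  Hoelder's inequality.  By Young's inequality the mean of \<open>\<bar>h\<bar>\<close> is at most
  \<open>4 \<parallel>1\<^sub>Q\<parallel>\<^sub>\<Psi> / \<bar>Q\<bar>\<close>, hence at most \<open>4 A / \<parallel>1\<^sub>Q\<parallel>\<^sub>\<Phi>\<close>.  The norms are doubled so that the modulars of
  the rescaled indicators are certainly at most one.
\<close>
lemma mean_bound: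
  assumes Q: "Q \<in> cubes n" and A: "0 < A"
    and prod: "lux_norm n \<Phi> (indicator Q) * lux_norm n \<Psi> (indicator Q) / emeasure (leb n) Q \<le> ennreal A"
    and h: "h \<in> borel_measurable (leb n)" "(\<integral>\<^sup>+x\<in>Q. \<Phi> x (ennreal \<bar>h x\<bar>) \<partial>leb n) \<le> 1"
  obtains m where "0 \<le> m" "mean n Q h = ennreal m"
    "(\<integral>\<^sup>+x\<in>Q. \<Phi> x (ennreal (m / (8 * A))) \<partial>leb n) \<le> 1"
proof -
  obtain v where v: "Q \<in> sets (leb n)" "0 < v" "emeasure (leb n) Q = ennreal v"
    using cubes_emeasure[OF Q] .
  let ?N1 = "lux_norm n \<Phi> (indicator Q)" and ?N2 = "lux_norm n \<Psi> (indicator Q)"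
  have pos: "0 < ?N1" "0 < ?N2"
    using Q by (auto intro: lux_norm_indicator_pos dual.lux_norm_indicator_pos)
  have prod': "?N1 * ?N2 \<le> ennreal (A * v)"
  proof -
    have "?N1 * ?N2 = ?N1 * ?N2 / ennreal v * ennreal v" using v by (simp add: ennreal_divide_times)
    also have "\<dots> \<le> ennreal A * ennreal v" using prod v by (intro mult_right_mono) auto
    finally show ?thesis using A v by (simp add: ennreal_mult)
  qed
  then have "?N1 * ?N2 < \<infinity>" by (auto intro: le_less_trans)
  then have fin: "?N1 < \<infinity>" "?N2 < \<infinity>"
    using pos by (auto simp: ennreal_mult_less_top zero_less_iff_neq_zero)
  obtain r1 where r1: "?N1 = ennreal r1" "0 < r1" using pos fin by (cases ?N1) auto
  obtain r2 where r2: "?N2 = ennreal r2" "0 < r2" using pos fin by (cases ?N2) auto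
  have r12: "r1 * r2 \<le> A * v"
    using prod' r1 r2 A v by (simp add: ennreal_mult[symmetric])
  have [measurable]: "Q \<in> sets (leb n)" "h \<in> borel_measurable (leb n)" using v h by auto
  have i1: "(\<integral>\<^sup>+x\<in>Q. \<Phi> x (ennreal (1 / (2 * r1))) \<partial>leb n) \<le> 1"
    using r1 by (intro indicator_integral_le_1_if_lux_norm_less) (auto simp: ennreal_less_iff)
  have i2: "(\<integral>\<^sup>+x\<in>Q. \<Psi> x (ennreal (1 / (2 * r2))) \<partial>leb n) \<le> 1"
    using r2 by (intro dual.indicator_integral_le_1_if_lux_norm_less) (auto simp: ennreal_less_iff)
  define I where "I = (\<integral>\<^sup>+x\<in>Q. ennreal \<bar>h x\<bar> \<partial>leb n)"
  have "ennreal (1 / (2 * r2)) * I = (\<integral>\<^sup>+x. ennreal (1 / (2 * r2)) * (ennreal \<bar>h x\<bar> * indicator Q x) \<partial>leb n)"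
    unfolding I_def by (intro nn_integral_cmult[symmetric]) auto
  also have "\<dots> \<le> (\<integral>\<^sup>+x. \<Phi> x (ennreal \<bar>h x\<bar>) * indicator Q x + \<Psi> x (ennreal (1 / (2 * r2))) * indicator Q x \<partial>leb n)"
  proof (intro nn_integral_mono)
    fix x assume "x \<in> space (leb n)"
    then have "ennreal (1 / (2 * r2)) * ennreal \<bar>h x\<bar> \<le> \<Phi> x (ennreal \<bar>h x\<bar>) + \<Psi> x (ennreal (1 / (2 * r2)))"
      using young[of x "\<bar>h x\<bar>" "1 / (2 * r2)"] r2 by (simp add: ennreal_mult[symmetric])
    then show "ennreal (1 / (2 * r2)) * (ennreal \<bar>h x\<bar> * indicator Q x)
        \<le> \<Phi> x (ennreal \<bar>h x\<bar>) * indicator Q x + \<Psi> x (ennreal (1 / (2 * r2))) * indicator Q x"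
      by (auto simp: indicator_def)
  qed
  also have "\<dots> = (\<integral>\<^sup>+x\<in>Q. \<Phi> x (ennreal \<bar>h x\<bar>) \<partial>leb n) + (\<integral>\<^sup>+x\<in>Q. \<Psi> x (ennreal (1 / (2 * r2))) \<partial>leb n)"
    using r2 measurable_comp[OF h(1)] dual.measurable_const[of "1 / (2 * r2)"]
    by (intro nn_integral_add) auto
  also have "\<dots> \<le> 1 + 1" using h i2 by (intro add_mono) auto
  finally have le: "ennreal (1 / (2 * r2)) * I \<le> 2" by (simp only: one_add_one)
  then have "ennreal (1 / (2 * r2)) * I < \<infinity>" by (rule le_less_trans) simp
  then have "I < \<infinity>" using r2 by (auto simp: ennreal_mult_less_top)
  then obtain i where i: "I = ennreal i" "0 \<le> i" by (cases I) auto
  have i_le: "i \<le> 4 * r2"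
  proof -
    have "ennreal (1 / (2 * r2) * i) = ennreal (1 / (2 * r2)) * I"
      unfolding i(1) using r2 i(2) by (intro ennreal_mult) auto
    also have "\<dots> \<le> ennreal 2" using le by simp
    finally have "1 / (2 * r2) * i \<le> 2" by (subst (asm) ennreal_le_iff) simp_all
    then show ?thesis using r2 by (simp add: divide_le_eq)
  qed
  have "mean n Q h = ennreal (i / v)" using i v by (simp add: mean_def divide_ennreal I_def[symmetric])
  moreover have "i / v / (8 * A) \<le> 1 / (2 * r1)"
  proof -
    have "i * r1 \<le> 4 * r2 * r1" using i_le r1 by simp
    also have "\<dots> \<le> 4 * (A * v)" using r12 by (simp add: mult.commute)
    finally show ?thesis using A v r1 by (simp add: field_simps)
  qed
  then have "(\<integral>\<^sup>+x\<in>Q. \<Phi> x (ennreal (i / v / (8 * A))) \<partial>leb n) \<le> 1"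
    using i1 v by (intro order_trans[OF set_integral_mono i1] ennreal_leI) auto
  ultimately show thesis using that[of "i / v"] i v by simp
qed

end

text \<open>
  The test function is a multiple of \<open>T\<close>, cut off where it is large: \<open>T\<close> need not be integrable on
  \<open>Q\<close>, but the modular of the constant \<open>s\<close> in \<open>\<Psi>\<close> still exceeds one on the part of \<open>Q\<close> where
  \<open>T \<le> k\<close>, for large \<open>k\<close>.
\<close>
lemma (in modular_fun) integral_const_bound:
  fixes \<Psi> :: phi_fun
  assumes bound: "modular_mean_bound n \<Phi> C" and Q: "Q \<in> cubes n" and s: "0 < s"
    and T: "T \<in> borel_measurable (leb n)" "\<And>x. x \<in> space (leb n) \<Longrightarrow> 0 \<le> T x"
    and up: "\<And>x. x \<in> space (leb n) \<Longrightarrow> \<Psi> x (ennreal s) \<le> ennreal (s * T x)"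
    and low: "\<And>x. x \<in> space (leb n) \<Longrightarrow> \<Phi> x (ennreal (T x)) \<le> ennreal (2 * (s * T x))"
    and meas: "(\<lambda>x. \<Psi> x (ennreal s)) \<in> borel_measurable (leb n)"
    and big: "1 < (\<integral>\<^sup>+x\<in>Q. \<Psi> x (ennreal s) \<partial>leb n)"
    and v: "emeasure (leb n) Q = ennreal v" "0 < v"
  shows "(\<integral>\<^sup>+x\<in>Q. \<Phi> x (ennreal (1 / (2 * s * v))) \<partial>leb n) \<le> ennreal C"
proof -
  have [measurable]: "Q \<in> sets (leb n)" using cubes_emeasure[OF Q] by auto
  note [measurable] = T(1) meas
  define E where "E k = Q \<inter> {x \<in> space (leb n). T x \<le> real k}" for k :: nat
  have [measurable]: "E k \<in> sets (leb n)" for k unfolding E_def by measurable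
  have "(\<integral>\<^sup>+x\<in>Q. \<Psi> x (ennreal s) \<partial>leb n) = (\<integral>\<^sup>+x. (SUP k. \<Psi> x (ennreal s) * indicator (E k) x) \<partial>leb n)"
  proof (intro nn_integral_cong)
    fix x assume x: "x \<in> space (leb n)"
    show "\<Psi> x (ennreal s) * indicator Q x = (SUP k. \<Psi> x (ennreal s) * indicator (E k) x)"
    proof (rule antisym)
      obtain k :: nat where "T x \<le> real k" using real_arch_simple by blast
      then have "\<Psi> x (ennreal s) * indicator Q x = \<Psi> x (ennreal s) * indicator (E k) x"
        using x by (auto simp: E_def indicator_def)
      then show "\<Psi> x (ennreal s) * indicator Q x \<le> (SUP k. \<Psi> x (ennreal s) * indicator (E k) x)"
        by (auto intro: SUP_upper)
    qed (auto intro!: SUP_least simp: E_def indicator_def)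
  qed
  also have "\<dots> = (SUP k. \<integral>\<^sup>+x. \<Psi> x (ennreal s) * indicator (E k) x \<partial>leb n)"
    by (intro nn_integral_monotone_convergence_SUP)
       (auto simp: incseq_def le_fun_def E_def indicator_def)
  finally obtain k where k: "1 < (\<integral>\<^sup>+x\<in>E k. \<Psi> x (ennreal s) \<partial>leb n)"
    using big by (auto simp: less_SUP_iff)
  define S where "S = (\<integral>\<^sup>+x\<in>E k. ennreal (T x) \<partial>leb n)"
  have "S \<le> (\<integral>\<^sup>+x. ennreal (real k) * indicator Q x \<partial>leb n)"
    unfolding S_def by (intro nn_integral_mono) (auto simp: E_def indicator_def intro: ennreal_leI)
  also have "\<dots> = ennreal (real k) * ennreal v" using v by (simp add: nn_integral_cmult_indicator)
  finally have "S < \<infinity>" by (auto intro: le_less_trans simp: ennreal_mult_less_top)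
  then obtain \<sigma> where \<sigma>: "S = ennreal \<sigma>" "0 \<le> \<sigma>" by (cases S) auto
  have "1 < s * \<sigma>"
  proof -
    note k
    also have "(\<integral>\<^sup>+x\<in>E k. \<Psi> x (ennreal s) \<partial>leb n) \<le> (\<integral>\<^sup>+x. ennreal s * (ennreal (T x) * indicator (E k) x) \<partial>leb n)"
      using up T s by (intro nn_integral_mono) (auto simp: indicator_def ennreal_mult)
    also have "\<dots> = ennreal s * S" unfolding S_def by (intro nn_integral_cmult) auto
    finally have "ennreal 1 < ennreal (s * \<sigma>)" using s \<sigma> by (simp add: ennreal_mult)
    then show ?thesis by (subst (asm) ennreal_less_iff) auto
  qed
  \<comment> \<open>normalisation: the modular of \<open>T\<close> on \<open>E k\<close> in \<open>\<Phi>\<close> is at most \<open>2 * s * \<sigma>\<close>\<close>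
  define c where "c = 1 / (2 * (s * \<sigma>))"
  have \<sigma>0: "0 < \<sigma>" using \<open>1 < s * \<sigma>\<close> s \<sigma>(2) by (cases "\<sigma> = 0") auto
  have c: "0 < c" "c \<le> 1" using \<open>1 < s * \<sigma>\<close> by (auto simp: c_def field_simps)
  define f where "f x = c * (T x * indicator (E k) x)" for x
  have [measurable]: "f \<in> borel_measurable (leb n)" unfolding f_def by measurable
  have EQ: "E k \<subseteq> Q" by (auto simp: E_def)
  have f1: "(\<integral>\<^sup>+x. \<Phi> x (ennreal \<bar>f x\<bar>) \<partial>leb n) \<le> 1"
  proof -
    have "(\<integral>\<^sup>+x. \<Phi> x (ennreal \<bar>f x\<bar>) \<partial>leb n) \<le> (\<integral>\<^sup>+x. ennreal (c * (2 * s)) * (ennreal (T x) * indicator (E k) x) \<partial>leb n)"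
    proof (intro nn_integral_mono)
      fix x assume x: "x \<in> space (leb n)"
      show "\<Phi> x (ennreal \<bar>f x\<bar>) \<le> ennreal (c * (2 * s)) * (ennreal (T x) * indicator (E k) x)"
      proof (cases "x \<in> E k")
        case True
        then have "\<Phi> x (ennreal \<bar>f x\<bar>) = \<Phi> x (ennreal (c * T x))" using c T x by (simp add: f_def)
        also have "\<dots> \<le> ennreal c * \<Phi> x (ennreal (T x))" using x c T by (intro scale) auto
        also have "\<dots> \<le> ennreal c * ennreal (2 * (s * T x))" using x by (intro mult_left_mono low) auto
        finally show ?thesis using True c s T x by (simp add: ennreal_mult[symmetric] mult_ac)
      qed (use zero x in \<open>simp add: f_def\<close>)
    qed
    also have "\<dots> = ennreal (c * (2 * s)) * S" unfolding S_def by (intro nn_integral_cmult) auto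
    also have "\<dots> = ennreal (c * (2 * s) * \<sigma>)" using \<sigma> c s by (simp add: ennreal_mult)
    also have "c * (2 * s) * \<sigma> = 1" using s \<sigma>0 by (simp add: c_def)
    finally show ?thesis by simp
  qed
  have mean: "mean n Q f = ennreal (1 / (2 * s * v))"
  proof -
    have "(\<integral>\<^sup>+y\<in>Q. ennreal \<bar>f y\<bar> \<partial>leb n) = (\<integral>\<^sup>+y. ennreal c * (ennreal (T y) * indicator (E k) y) \<partial>leb n)"
      using T c EQ by (intro nn_integral_cong) (auto simp: f_def indicator_def abs_mult ennreal_mult)
    also have "\<dots> = ennreal c * S" unfolding S_def by (intro nn_integral_cmult) auto
    also have "\<dots> = ennreal (1 / (2 * s))" using \<sigma> c s \<sigma>0 by (simp add: ennreal_mult[symmetric] c_def)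
    finally show ?thesis using v s by (simp add: mean_def divide_ennreal)
  qed
  have "(\<integral>\<^sup>+x\<in>Q. \<Phi> x (mean n Q f) \<partial>leb n) \<le> ennreal C * (\<integral>\<^sup>+x\<in>Q. \<Phi> x (ennreal \<bar>f x\<bar>) \<partial>leb n)"
    using bound Q lux_norm_le_1[OF _ f1] unfolding modular_mean_bound_def by auto
  also have "\<dots> \<le> ennreal C * 1"
  proof (intro mult_left_mono)
    have "(\<integral>\<^sup>+x\<in>Q. \<Phi> x (ennreal \<bar>f x\<bar>) \<partial>leb n) \<le> (\<integral>\<^sup>+x. \<Phi> x (ennreal \<bar>f x\<bar>) \<partial>leb n)"
      by (intro nn_integral_mono) (simp add: indicator_def)
    also note f1
    finally show "(\<integral>\<^sup>+x\<in>Q. \<Phi> x (ennreal \<bar>f x\<bar>) \<partial>leb n) \<le> 1" .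
  qed simp
  finally have "(\<integral>\<^sup>+x\<in>Q. \<Phi> x (mean n Q f) \<partial>leb n) \<le> ennreal C" by (simp only: mult_1_right)
  then show ?thesis by (simp only: mean)
qed

text \<open>
  For \<open>r < \<parallel>1\<^sub>Q\<parallel>\<^sub>\<Psi>\<close> the constant \<open>1 / r\<close> has modular greater than one in \<open>\<Psi>\<close>, so testing
  bounds the modular of \<open>r / (2 \<bar>Q\<bar>)\<close> in \<open>\<Phi>\<close> by \<open>C\<close>; dividing by \<open>C + 1\<close> turns this into a bound
  for \<open>\<parallel>1\<^sub>Q\<parallel>\<^sub>\<Phi>\<close>.
\<close>
lemma (in young_pair) lux_norm_product_bound:
  assumes bound: "modular_mean_bound n \<Phi> C" and C: "0 < C" and Q: "Q \<in> cubes n"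
    and T: "\<And>s. 0 < s \<Longrightarrow> T s \<in> borel_measurable (leb n)"
      "\<And>s x. 0 < s \<Longrightarrow> x \<in> space (leb n) \<Longrightarrow> 0 \<le> T s x"
    and up: "\<And>s x. 0 < s \<Longrightarrow> x \<in> space (leb n) \<Longrightarrow> \<Psi> x (ennreal s) \<le> ennreal (s * T s x)"
    and low: "\<And>s x. 0 < s \<Longrightarrow> x \<in> space (leb n) \<Longrightarrow> \<Phi> x (ennreal (T s x)) \<le> ennreal (2 * (s * T s x))"
  shows "lux_norm n \<Phi> (indicator Q) * lux_norm n \<Psi> (indicator Q) / emeasure (leb n) Q \<le> ennreal (2 * (C + 1))"
proof -
  obtain v where v: "Q \<in> sets (leb n)" "0 < v" "emeasure (leb n) Q = ennreal v"
    using cubes_emeasure[OF Q] .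
  let ?N1 = "lux_norm n \<Phi> (indicator Q)" and ?N2 = "lux_norm n \<Psi> (indicator Q)"
  have [measurable]: "Q \<in> sets (leb n)" using v by auto
  have bd: "?N1 * ennreal r \<le> ennreal (2 * (C + 1) * v)" if r: "0 < r" "ennreal r < ?N2" for r
  proof -
    let ?c = "1 / (C + 1)"
    have "\<not> (\<integral>\<^sup>+x\<in>Q. \<Psi> x (ennreal (1 / r)) \<partial>leb n) \<le> 1"
      using dual.lux_norm_indicator_le[of r Q] r by auto
    then have "(\<integral>\<^sup>+x\<in>Q. \<Phi> x (ennreal (1 / (2 * (1 / r) * v))) \<partial>leb n) \<le> ennreal C"
      using r T[of "1 / r"] up[of "1 / r"] low[of "1 / r"] dual.measurable_const[of "1 / r"] v
      by (intro integral_const_bound[OF bound Q, where T = "T (1 / r)" and \<Psi> = \<Psi>]) auto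
    moreover have "1 / (2 * (1 / r) * v) = r / (2 * v)" by simp
    ultimately have le: "(\<integral>\<^sup>+x\<in>Q. \<Phi> x (ennreal (r / (2 * v))) \<partial>leb n) \<le> ennreal C" by simp
    have [measurable]: "(\<lambda>x. \<Phi> x (ennreal (r / (2 * v)))) \<in> borel_measurable (leb n)"
      using measurable_const[of "r / (2 * v)"] v r by simp
    have c: "0 < ?c" "?c \<le> 1" using C by auto
    have "(\<integral>\<^sup>+x\<in>Q. \<Phi> x (ennreal (?c * (r / (2 * v)))) \<partial>leb n) \<le>
        (\<integral>\<^sup>+x. ennreal ?c * (\<Phi> x (ennreal (r / (2 * v))) * indicator Q x) \<partial>leb n)"
    proof (intro nn_integral_mono)
      fix x assume "x \<in> space (leb n)"
      then show "\<Phi> x (ennreal (?c * (r / (2 * v)))) * indicator Q x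
          \<le> ennreal ?c * (\<Phi> x (ennreal (r / (2 * v))) * indicator Q x)"
        using scale[of x ?c "r / (2 * v)"] c r v by (auto simp: indicator_def)
    qed
    also have "\<dots> = ennreal ?c * (\<integral>\<^sup>+x\<in>Q. \<Phi> x (ennreal (r / (2 * v))) \<partial>leb n)"
      by (intro nn_integral_cmult) auto
    also have "\<dots> \<le> ennreal ?c * ennreal C" by (intro mult_left_mono le) auto
    also have "\<dots> = ennreal (?c * C)" using C by (subst ennreal_mult[symmetric]) auto
    also have "\<dots> \<le> 1" using C by (subst ennreal_le_1) auto
    finally have "(\<integral>\<^sup>+x\<in>Q. \<Phi> x (ennreal (1 / (2 * (C + 1) * v / r))) \<partial>leb n) \<le> 1"
      by (simp add: mult_ac)
    then have "?N1 \<le> ennreal (2 * (C + 1) * v / r)"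
      using C v r by (intro lux_norm_indicator_le) auto
    then have "?N1 * ennreal r \<le> ennreal (2 * (C + 1) * v / r) * ennreal r"
      by (intro mult_right_mono) auto
    also have "\<dots> = ennreal (2 * (C + 1) * v)" using C v r by (simp add: ennreal_mult[symmetric])
    finally show ?thesis .
  qed
  have "?N1 * ?N2 \<le> ennreal (2 * (C + 1) * v)"
    proof (rule ennreal_mult_le_if_less)
      fix y assume y: "y < ?N2"
      then obtain r where r: "y = ennreal r" "0 \<le> r" by (cases y) auto
      show "?N1 * y \<le> ennreal (2 * (C + 1) * v)"
        using bd[of r] r y by (cases "r = 0") auto
    qed
  then have "?N1 * ?N2 / ennreal v \<le> ennreal (2 * (C + 1) * v) / ennreal v"
    by (rule divide_right_mono_ennreal)
  also have "\<dots> = ennreal (2 * (C + 1))" using C v by (simp add: divide_ennreal)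
  finally show ?thesis using v by simp
qed

text \<open>
  Norm at most one only says that the modular of \<open>f / r\<close> is at most one for every \<open>r > 1\<close>.
  Passing to \<open>h = f / 2\<close> avoids a limit in \<open>r\<close>, at the price of a doubling constant.
\<close>
lemma (in modular_fun) modular_mean_boundI:
  assumes doubling: "\<And>x t. x \<in> space (leb n) \<Longrightarrow> 0 \<le> t \<Longrightarrow>
      \<Phi> x (ennreal (2 * t)) \<le> ennreal D * \<Phi> x (ennreal t)" and D: "0 \<le> D" and K: "0 \<le> K"
    and main: "\<And>h Q. h \<in> borel_measurable (leb n) \<Longrightarrow> Q \<in> cubes n \<Longrightarrow>
      (\<integral>\<^sup>+x\<in>Q. \<Phi> x (ennreal \<bar>h x\<bar>) \<partial>leb n) \<le> 1 \<Longrightarrow>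
      \<exists>m\<ge>0. mean n Q h = ennreal m \<and>
        (\<integral>\<^sup>+x\<in>Q. \<Phi> x (ennreal m) \<partial>leb n) \<le> ennreal K * (\<integral>\<^sup>+x\<in>Q. \<Phi> x (ennreal \<bar>h x\<bar>) \<partial>leb n)"
  shows "modular_mean_bound n \<Phi> (D * K)"
  unfolding modular_mean_bound_def
proof (intro ballI impI)
  fix f Q assume f: "f \<in> L_space n \<Phi>" "lux_norm n \<Phi> f \<le> 1" and Q: "Q \<in> cubes n"
  have [measurable]: "f \<in> borel_measurable (leb n)" "Q \<in> sets (leb n)"
    using f cubes_emeasure[OF Q] by (auto simp: L_space_def)
  define h where "h x = f x / 2" for x
  have hm[measurable]: "h \<in> borel_measurable (leb n)" unfolding h_def by measurable
  have "lux_norm n \<Phi> f < ennreal 2" using f(2) by (rule le_less_trans) simp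
  from integral_le_1_if_lux_norm_less[OF this]
  have 1: "(\<integral>\<^sup>+x. \<Phi> x (ennreal \<bar>h x\<bar>) \<partial>leb n) \<le> 1" by (simp add: h_def)
  have "(\<integral>\<^sup>+x\<in>Q. \<Phi> x (ennreal \<bar>h x\<bar>) \<partial>leb n) \<le> (\<integral>\<^sup>+x. \<Phi> x (ennreal \<bar>h x\<bar>) \<partial>leb n)"
    by (intro nn_integral_mono) (simp add: indicator_def)
  also note 1
  finally obtain m where m: "0 \<le> m" "mean n Q h = ennreal m"
    "(\<integral>\<^sup>+x\<in>Q. \<Phi> x (ennreal m) \<partial>leb n) \<le> ennreal K * (\<integral>\<^sup>+x\<in>Q. \<Phi> x (ennreal \<bar>h x\<bar>) \<partial>leb n)"
    using main[OF hm Q] by blast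
  have "mean n Q f = mean n Q (\<lambda>x. 2 * h x)" by (simp add: h_def)
  also have "\<dots> = ennreal (2 * m)" using m by (subst mean_cmult) (simp_all add: ennreal_mult)
  finally have mf: "mean n Q f = ennreal (2 * m)" .
  have "(\<integral>\<^sup>+x\<in>Q. \<Phi> x (mean n Q f) \<partial>leb n) \<le> (\<integral>\<^sup>+x. ennreal D * (\<Phi> x (ennreal m) * indicator Q x) \<partial>leb n)"
    unfolding mf
  proof (intro nn_integral_mono)
    fix x assume "x \<in> space (leb n)"
    then show "\<Phi> x (ennreal (2 * m)) * indicator Q x \<le> ennreal D * (\<Phi> x (ennreal m) * indicator Q x)"
      using doubling[of x m] m by (simp add: indicator_def)
  qed
  also have "\<dots> = ennreal D * (\<integral>\<^sup>+x\<in>Q. \<Phi> x (ennreal m) \<partial>leb n)"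
    using measurable_const[of m] m by (intro nn_integral_cmult) simp
  also have "\<dots> \<le> ennreal D * (ennreal K * (\<integral>\<^sup>+x\<in>Q. \<Phi> x (ennreal \<bar>h x\<bar>) \<partial>leb n))"
    by (intro mult_left_mono m) simp
  also have "\<dots> = ennreal (D * K) * (\<integral>\<^sup>+x\<in>Q. \<Phi> x (ennreal \<bar>h x\<bar>) \<partial>leb n)"
    using D K by (simp add: ennreal_mult mult.assoc)
  also have "\<dots> \<le> ennreal (D * K) * (\<integral>\<^sup>+x\<in>Q. \<Phi> x (ennreal \<bar>f x\<bar>) \<partial>leb n)"
    by (intro mult_left_mono nn_integral_mono mult_right_mono mono ennreal_leI) (auto simp: h_def)
  finally show "(\<integral>\<^sup>+x\<in>Q. \<Phi> x (mean n Q f) \<partial>leb n)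
      \<le> ennreal (D * K) * (\<integral>\<^sup>+x\<in>Q. \<Phi> x (ennreal \<bar>f x\<bar>) \<partial>leb n)" .
qed

lemma (in young_pair) scaled_mean_bound:
  assumes Q: "Q \<in> cubes n" and A: "0 < A"
    and prod: "lux_norm n \<Phi> (indicator Q) * lux_norm n \<Psi> (indicator Q) / emeasure (leb n) Q \<le> ennreal A"
    and h: "h \<in> borel_measurable (leb n)" "mean n Q h = ennreal m" "0 \<le> m" and c: "0 < c"
    and le: "(\<integral>\<^sup>+x\<in>Q. \<Phi> x (ennreal (\<bar>h x\<bar> / c)) \<partial>leb n) \<le> 1"
  shows "(\<integral>\<^sup>+x\<in>Q. \<Phi> x (ennreal (m / (8 * A * c))) \<partial>leb n) \<le> 1"
proof -
  have [measurable]: "h \<in> borel_measurable (leb n)" "Q \<in> sets (leb n)"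
    using h cubes_emeasure[OF Q] by auto
  have "(\<integral>\<^sup>+x\<in>Q. \<Phi> x (ennreal \<bar>1 / c * h x\<bar>) \<partial>leb n) \<le> 1" using le c by (simp add: abs_mult)
  then obtain m' where m': "0 \<le> m'" "mean n Q (\<lambda>x. 1 / c * h x) = ennreal m'"
    "(\<integral>\<^sup>+x\<in>Q. \<Phi> x (ennreal (m' / (8 * A))) \<partial>leb n) \<le> 1"
    using mean_bound[OF Q A prod, of "\<lambda>x. 1 / c * h x"] by auto
  have "mean n Q (\<lambda>x. 1 / c * h x) = ennreal \<bar>1 / c\<bar> * ennreal m"
    unfolding h(2)[symmetric] by (rule mean_cmult) measurable
  also have "\<dots> = ennreal (m / c)" using c h by (simp add: ennreal_mult[symmetric])
  finally have "m' = m / c" using m' c h by simp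
  then show ?thesis using m'(3) by (simp add: mult_ac)
qed


section \<open>The double phase function as a pair in Young duality\<close>

locale double_phase_setting = exponents p q for p q :: real +
  fixes n :: nat and a :: "point \<Rightarrow> real"
  assumes a_measurable[measurable]: "a \<in> borel_measurable (leb n)"
    and a_nonneg: "x \<in> space (leb n) \<Longrightarrow> 0 \<le> a x"
begin

abbreviation \<phi> :: phi_fun where "\<phi> \<equiv> double_phase p q a"
abbreviation \<phi>c :: phi_fun where "\<phi>c \<equiv> conjugate \<phi>"

lemma phi_ennreal: "0 \<le> t \<Longrightarrow> \<phi> x (ennreal t) = ennreal (dp (a x) t)"
  by (simp add: double_phase_def dp_def)

lemma conj_eq_SUP:
  assumes "x \<in> space (leb n)" "0 \<le> s"
  shows "\<phi>c x (ennreal s) = (SUP t\<in>{0..}. ennreal (s * t - dp (a x) t))"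
proof -
  have "{..<\<infinity>} = ennreal ` {0..}"
  proof (intro equalityI subsetI)
    fix t :: ennreal assume "t \<in> {..<\<infinity>}"
    then show "t \<in> ennreal ` {0..}" by (cases t) auto
  qed auto
  then have "\<phi>c x (ennreal s) = (SUP t\<in>{0..}. ennreal s * ennreal t - \<phi> x (ennreal t))"
    by (simp add: conjugate_def image_image)
  also have "\<dots> = (SUP t\<in>{0..}. ennreal (s * t - dp (a x) t))"
    using assms a_nonneg[of x]
    by (intro SUP_cong) (auto simp: phi_ennreal ennreal_minus dp_nonneg ennreal_mult[symmetric])
  finally show ?thesis .
qed

lemma conj_ge:
  assumes "x \<in> space (leb n)" "0 \<le> s" "0 \<le> t"
  shows "ennreal (s * t - dp (a x) t) \<le> \<phi>c x (ennreal s)"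
  using assms by (subst conj_eq_SUP) (auto intro: SUP_upper)

lemma conj_leI:
  assumes "x \<in> space (leb n)" "0 \<le> s" "\<And>t. 0 \<le> t \<Longrightarrow> ennreal (s * t - dp (a x) t) \<le> y"
  shows "\<phi>c x (ennreal s) \<le> y"
  using assms by (subst conj_eq_SUP) (auto intro: SUP_least)

text \<open>
  A countable supremum, which makes the conjugate measurable in \<open>x\<close>.  Since \<open>dp\<close> is increasing in
  \<open>t\<close>, moving \<open>t\<close> down to a nearby rational number can only lose in the linear term.
\<close>
lemma conj_eq_SUP_Rats:
  assumes "x \<in> space (leb n)" "0 \<le> s"
  shows "\<phi>c x (ennreal s) = (SUP t\<in>\<rat> \<inter> {0..}. ennreal (s * t - dp (a x) t))" (is "_ = ?S")
proof (rule antisym)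
  show "?S \<le> \<phi>c x (ennreal s)" using assms by (intro SUP_least conj_ge) auto
  show "\<phi>c x (ennreal s) \<le> ?S"
  proof (rule conj_leI[OF assms])
    fix t :: real assume t: "0 \<le> t"
    show "ennreal (s * t - dp (a x) t) \<le> ?S"
    proof (rule ennreal_le_epsilon)
      fix e :: real assume e: "0 < e"
      obtain r where r: "r \<in> \<rat>" "0 \<le> r" "r \<le> t" "s * t - e \<le> s * r"
      proof (cases "t = 0")
        case True
        then show thesis using that[of 0] e by simp
      next
        case False
        define \<delta> where "\<delta> = e / (s + 1)"
        have "0 < \<delta>" using e assms by (simp add: \<delta>_def)
        then have "max 0 (t - \<delta>) < t" using t False by auto
        then obtain r where r: "r \<in> \<rat>" "max 0 (t - \<delta>) < r" "r < t" using Rats_dense_in_real by blast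
        have "s * (t - r) \<le> (s + 1) * \<delta>" using r assms by (intro mult_mono) auto
        also have "\<dots> = e" using assms by (simp add: \<delta>_def)
        finally show thesis using that[of r] r by (simp add: algebra_simps)
      qed
      have "dp (a x) r \<le> dp (a x) t" using r a_nonneg assms by (intro dp_mono) auto
      then have "s * t - dp (a x) t \<le> (s * r - dp (a x) r) + e" using r by simp
      then have "ennreal (s * t - dp (a x) t) \<le> ennreal (max 0 (s * r - dp (a x) r) + e)"
        by (intro ennreal_leI) simp
      also have "\<dots> = ennreal (max 0 (s * r - dp (a x) r)) + ennreal e" using e by (intro ennreal_plus) auto
      also have "ennreal (max 0 (s * r - dp (a x) r)) = ennreal (s * r - dp (a x) r)"
        by (simp add: max_def ennreal_neg)
      also have "ennreal (s * r - dp (a x) r) \<le> ?S" using r by (intro SUP_upper) auto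
      finally show "ennreal (s * t - dp (a x) t) \<le> ?S + ennreal e" by (simp add: add_right_mono)
    qed
  qed
qed

lemma conj_upper:
  assumes "x \<in> space (leb n)" "0 \<le> s"
  shows "\<phi>c x (ennreal s) \<le> ennreal (s * conj_slope (a x) s)"
  using assms a_nonneg by (intro conj_leI ennreal_leI conjugate_upper) auto

lemma conj_lower:
  assumes "x \<in> space (leb n)" "0 \<le> s"
  shows "ennreal (s * conj_slope (a x) s) \<le> ennreal equiv_const * \<phi>c x (ennreal s)"
proof -
  define t where "t = conj_slope (a x) s / 4 powr (1 / (p - 1))"
  have t: "0 \<le> t" by (simp add: t_def conj_slope_nonneg)
  have c: "0 \<le> equiv_const" using equiv_const_ge_1 by simp
  have "ennreal (s * conj_slope (a x) s) \<le> ennreal (equiv_const * (s * t - dp (a x) t))"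
    unfolding t_def using assms a_nonneg by (intro ennreal_leI conjugate_lower) auto
  also have "\<dots> = ennreal equiv_const * ennreal (s * t - dp (a x) t)"
    using c by (simp add: ennreal_mult')
  also have "\<dots> \<le> ennreal equiv_const * \<phi>c x (ennreal s)"
    using assms t by (intro mult_left_mono conj_ge) auto
  finally show ?thesis .
qed

text \<open>
  Carries scaling properties of \<open>s * conj_slope b s\<close> over to the conjugate function, with the
  constant of equivalence as the only loss.
\<close>
lemma conj_le_of_slope_le:
  assumes x: "x \<in> space (leb n)" and s: "0 \<le> s" "0 \<le> s'" and k: "0 \<le> k"
    and le: "s' * conj_slope (a x) s' \<le> k * (s * conj_slope (a x) s)"
  shows "\<phi>c x (ennreal s') \<le> ennreal (equiv_const * k) * \<phi>c x (ennreal s)"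
proof -
  have "\<phi>c x (ennreal s') \<le> ennreal (s' * conj_slope (a x) s')" using x s by (intro conj_upper) auto
  also have "\<dots> \<le> ennreal (k * (s * conj_slope (a x) s))" by (rule ennreal_leI) (rule le)
  also have "\<dots> = ennreal k * ennreal (s * conj_slope (a x) s)" using k by (simp add: ennreal_mult')
  also have "\<dots> \<le> ennreal k * (ennreal equiv_const * \<phi>c x (ennreal s))"
    using x s by (intro mult_left_mono conj_lower) auto
  finally show ?thesis using k equiv_const_ge_1 by (simp add: ennreal_mult mult_ac)
qed

lemma conj_scale_up:
  assumes "x \<in> space (leb n)" "0 \<le> s" "1 \<le> k"
  shows "\<phi>c x (ennreal (k * s)) \<le> ennreal (equiv_const * k powr (1 + 1 / (p - 1))) * \<phi>c x (ennreal s)"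
proof (rule conj_le_of_slope_le)
  have "k * s * conj_slope (a x) (k * s) \<le> k * s * (k powr (1 / (p - 1)) * conj_slope (a x) s)"
    using assms a_nonneg by (intro mult_left_mono conj_slope_scale_up) auto
  then show "k * s * conj_slope (a x) (k * s) \<le> k powr (1 + 1 / (p - 1)) * (s * conj_slope (a x) s)"
    using assms by (simp add: powr_add mult_ac)
qed (use assms in auto)

lemma conj_scale_down:
  assumes "x \<in> space (leb n)" "0 \<le> s" "0 < k" "k \<le> 1"
  shows "\<phi>c x (ennreal (k * s)) \<le> ennreal (equiv_const * k powr (1 + 1 / (q - 1))) * \<phi>c x (ennreal s)"
proof (rule conj_le_of_slope_le)
  have "k * s * conj_slope (a x) (k * s) \<le> k * s * (k powr (1 / (q - 1)) * conj_slope (a x) s)"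
    using assms a_nonneg by (intro mult_left_mono conj_slope_scale_down) auto
  then show "k * s * conj_slope (a x) (k * s) \<le> k powr (1 + 1 / (q - 1)) * (s * conj_slope (a x) s)"
    using assms by (simp add: powr_add mult_ac)
qed (use assms in auto)

lemma dp_measurable[measurable]:
  assumes [measurable]: "f \<in> borel_measurable (leb n)"
  shows "(\<lambda>x. dp (a x) (f x)) \<in> borel_measurable (leb n)"
  unfolding dp_def by measurable

lemma conj_slope_measurable[measurable]:
  assumes [measurable]: "f \<in> borel_measurable (leb n)"
  shows "(\<lambda>x. conj_slope (a x) (f x)) \<in> borel_measurable (leb n)"
  unfolding conj_slope_def by measurable

lemma young_phi:
  assumes "x \<in> space (leb n)" "0 \<le> s" "0 \<le> t"
  shows "ennreal (s * t) \<le> \<phi> x (ennreal s) + \<phi>c x (ennreal t)"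
proof -
  have d: "0 \<le> dp (a x) s" using assms a_nonneg by (intro dp_nonneg) auto
  have "ennreal (s * t) \<le> ennreal (dp (a x) s + max 0 (t * s - dp (a x) s))"
    by (intro ennreal_leI) (simp add: mult.commute)
  also have "\<dots> = ennreal (dp (a x) s) + ennreal (max 0 (t * s - dp (a x) s))"
    using d by (intro ennreal_plus) auto
  also have "ennreal (max 0 (t * s - dp (a x) s)) = ennreal (t * s - dp (a x) s)"
    by (simp add: max_def ennreal_neg)
  also have "ennreal (dp (a x) s) + ennreal (t * s - dp (a x) s) \<le> \<phi> x (ennreal s) + \<phi>c x (ennreal t)"
    using assms by (intro add_mono conj_ge) (auto simp: phi_ennreal)
  finally show ?thesis .
qed

sublocale modular_fun n \<phi>
proof
  fix x assume x: "x \<in> space (leb n)"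
  have ax: "0 \<le> a x" using x by (rule a_nonneg)
  show "\<phi> x 0 = 0" using phi_ennreal[of 0 x] by (simp add: dp_0)
  show "0 < \<phi> x 1"
    using phi_ennreal[of 1 x] ax p q by (simp add: dp_def add_pos_nonneg)
  show "\<phi> x u \<le> \<phi> x w" if "u \<le> w" for u w
  proof (cases w)
    case w: (real w')
    then obtain u' where "u = ennreal u'" "0 \<le> u'" using \<open>u \<le> w\<close> by (cases u) (auto simp: top_unique)
    then show ?thesis using w that ax by (simp add: phi_ennreal ennreal_leI dp_mono)
  qed (simp add: double_phase_def)
  show "\<phi> x (ennreal (c * t)) \<le> ennreal c * \<phi> x (ennreal t)" if "0 < c" "c \<le> 1" "0 \<le> t" for c t
  proof -
    have "dp (a x) (c * t) \<le> c powr p * dp (a x) t" using that ax by (intro dp_scale_down) auto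
    also have "\<dots> \<le> c powr 1 * dp (a x) t"
      using that ax p by (intro mult_right_mono powr_mono' dp_nonneg) auto
    finally show ?thesis using that by (simp add: phi_ennreal ennreal_mult'[symmetric] ennreal_leI)
  qed
next
  fix f :: "point \<Rightarrow> real" assume [measurable]: "f \<in> borel_measurable (leb n)"
  show "(\<lambda>x. \<phi> x (ennreal \<bar>f x\<bar>)) \<in> borel_measurable (leb n)"
    by (simp add: phi_ennreal)
qed

sublocale conj: modular_fun n \<phi>c
proof
  fix x assume x: "x \<in> space (leb n)"
  have ax: "0 \<le> a x" using x by (rule a_nonneg)
  show "\<phi>c x 0 = 0" using conj_upper[of x 0] x by simp
  show "0 < \<phi>c x 1"
  proof (rule ccontr)
    assume "\<not> 0 < \<phi>c x 1"
    then have "\<phi>c x 1 = 0" by (simp add: zero_less_iff_neq_zero)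
    then have "ennreal (conj_slope (a x) 1) \<le> 0" using conj_lower[of x 1] x by simp
    then show False using conj_slope_pos[of 1 "a x"] ax by simp
  qed
  show "\<phi>c x u \<le> \<phi>c x w" if "u \<le> w" for u w
    unfolding conjugate_def using that
    by (auto simp: top_unique intro!: SUP_mono' ennreal_minus_mono mult_right_mono)
  show "\<phi>c x (ennreal (c * t)) \<le> ennreal c * \<phi>c x (ennreal t)" if c: "0 < c" "c \<le> 1" "0 \<le> t" for c t
  proof (rule conj_leI[OF x])
    fix u :: real assume u: "0 \<le> u"
    have "c * dp (a x) u \<le> 1 * dp (a x) u" using c ax by (intro mult_right_mono dp_nonneg) auto
    then have "c * t * u - dp (a x) u \<le> c * (t * u - dp (a x) u)" by (simp add: algebra_simps)
    then have "ennreal (c * t * u - dp (a x) u) \<le> ennreal (c * (t * u - dp (a x) u))" by (rule ennreal_leI)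
    also have "\<dots> = ennreal c * ennreal (t * u - dp (a x) u)" using c by (simp add: ennreal_mult')
    also have "\<dots> \<le> ennreal c * \<phi>c x (ennreal t)" using c u x by (intro mult_left_mono conj_ge) auto
    finally show "ennreal (c * t * u - dp (a x) u) \<le> ennreal c * \<phi>c x (ennreal t)" .
  qed (use c in auto)
next
  fix f :: "point \<Rightarrow> real" assume [measurable]: "f \<in> borel_measurable (leb n)"
  have "(\<lambda>x. SUP t\<in>\<rat> \<inter> {0..}. ennreal (\<bar>f x\<bar> * t - dp (a x) t)) \<in> borel_measurable (leb n)"
    by (intro borel_measurable_SUP) (auto intro: countable_rat)
  then show "(\<lambda>x. \<phi>c x (ennreal \<bar>f x\<bar>)) \<in> borel_measurable (leb n)"
    by (subst measurable_cong[OF conj_eq_SUP_Rats]) auto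
qed

sublocale pair: young_pair n \<phi> \<phi>c
  by standard (rule young_phi)

sublocale dual_pair: young_pair n \<phi>c \<phi>
proof
  fix x and s t :: real assume "x \<in> space (leb n)" "0 \<le> s" "0 \<le> t"
  then show "ennreal (s * t) \<le> \<phi>c x (ennreal s) + \<phi> x (ennreal t)"
    using young_phi[of x t s] by (simp add: mult.commute add.commute)
qed

section \<open>The class constant bounded by the constants of the modular inequalities\<close>

lemma A_constD:
  assumes "A_const n \<phi> \<le> ennreal A" "Q \<in> cubes n"
  shows "lux_norm n \<phi> (indicator Q) * lux_norm n \<phi>c (indicator Q) / emeasure (leb n) Q \<le> ennreal A"
  using SUP_upper[OF assms(2)] assms(1) unfolding A_const_def by (rule order_trans)

lemma A_const_if_modular_mean_bound:
  assumes "modular_mean_bound n \<phi> C" "0 < C"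
  shows "A_const n \<phi> \<le> ennreal (2 * (C + 1))"
  unfolding A_const_def
proof (rule SUP_least, rule pair.lux_norm_product_bound[OF assms])
  fix x and s :: real assume x: "x \<in> space (leb n)" and s: "0 < s"
  show "\<phi>c x (ennreal s) \<le> ennreal (s * conj_slope (a x) s)" using x s by (intro conj_upper) auto
  show "\<phi> x (ennreal (conj_slope (a x) s)) \<le> ennreal (2 * (s * conj_slope (a x) s))"
    using x s a_nonneg by (simp add: phi_ennreal conj_slope_nonneg ennreal_leI dp_conj_slope)
qed (auto simp: conj_slope_nonneg)

text \<open>
  The class constant is symmetric in \<open>\<phi>\<close> and its conjugate.  The test functions are now
  the derivatives of \<open>\<phi>\<close> in \<open>t\<close>; they need not be integrable on a cube, since \<open>a\<close> need not be.
\<close>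
lemma A_const_if_conj_modular_mean_bound:
  assumes "modular_mean_bound n \<phi>c C" "0 < C"
  shows "A_const n \<phi> \<le> ennreal (2 * (C + 1))"
  unfolding A_const_def
proof (rule SUP_least)
  fix Q assume Q: "Q \<in> cubes n"
  define T where "T s x = s powr (p - 1) + a x * s powr (q - 1)" for s x
  have T0: "0 \<le> T s x" if "x \<in> space (leb n)" for s x
    unfolding T_def using a_nonneg[OF that] by simp
  have "lux_norm n \<phi>c (indicator Q) * lux_norm n \<phi> (indicator Q) / emeasure (leb n) Q \<le> ennreal (2 * (C + 1))"
  proof (rule dual_pair.lux_norm_product_bound[OF assms Q, where T = T])
    fix x and s :: real assume x: "x \<in> space (leb n)" and s: "0 < s"
    have "dp (a x) s \<le> 1 * s powr p + 1 * (a x * s powr q)"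
      unfolding dp_def mult.assoc using p q a_nonneg[OF x] by (intro add_mono mult_right_mono) auto
    also have "\<dots> = s * T s x" using s by (simp add: T_def powr_diff algebra_simps)
    finally show "\<phi> x (ennreal s) \<le> ennreal (s * T s x)" using s by (simp add: phi_ennreal ennreal_leI)
    show "\<phi>c x (ennreal (T s x)) \<le> ennreal (2 * (s * T s x))"
    proof (rule conj_leI[OF x T0[OF x]], rule ennreal_leI)
      fix u :: real assume "0 \<le> u"
      then have "T s x * u - dp (a x) u \<le> s * T s x"
        unfolding T_def using s a_nonneg[OF x] by (intro slope_young) auto
      moreover have "0 \<le> s * T s x" using s T0[OF x] by simp
      ultimately show "T s x * u - dp (a x) u \<le> 2 * (s * T s x)" by simp
    qed
  next
    fix s :: real
    show "T s \<in> borel_measurable (leb n)" unfolding T_def by measurable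
  qed (rule T0)
  then show "lux_norm n \<phi> (indicator Q) * lux_norm n \<phi>c (indicator Q) / emeasure (leb n) Q \<le> ennreal (2 * (C + 1))"
    by (simp add: mult.commute)
qed

section \<open>The modular inequalities for a given class constant\<close>

text \<open>
  The two terms of the modular of the mean are treated separately: Jensen for the exponent \<open>p\<close>,
  rescaling by \<open>c = J powr (1 / q)\<close> for the exponent \<open>q\<close>.
\<close>
lemma phi_modular_mean_bound_if_A_const:
  assumes A: "A_const n \<phi> \<le> ennreal A" "1 \<le> A"
  shows "modular_mean_bound n \<phi> (K_phi A)"
  unfolding K_phi_def
proof (rule modular_mean_boundI)
  fix x and t :: real assume "x \<in> space (leb n)" "0 \<le> t"
  then show "\<phi> x (ennreal (2 * t)) \<le> ennreal (2 powr q) * \<phi> x (ennreal t)"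
    using dp_scale_up[of "a x" t 2] a_nonneg
    by (simp add: phi_ennreal ennreal_mult'[symmetric] ennreal_leI)
next
  fix h Q assume h[measurable]: "h \<in> borel_measurable (leb n)" and Q: "Q \<in> cubes n"
    and le1: "(\<integral>\<^sup>+x\<in>Q. \<phi> x (ennreal \<bar>h x\<bar>) \<partial>leb n) \<le> 1"
  have A0: "0 < A" using A by simp
  note prod = A_constD[OF A(1) Q]
  obtain v where v: "Q \<in> sets (leb n)" "0 < v" "emeasure (leb n) Q = ennreal v"
    using cubes_emeasure[OF Q] .
  have [measurable]: "Q \<in> sets (leb n)" by (rule v)
  obtain m where m: "0 \<le> m" "mean n Q h = ennreal m"
    using pair.mean_bound[OF Q A0 prod h le1] by metis
  have "(\<integral>\<^sup>+x\<in>Q. \<phi> x (ennreal m) \<partial>leb n) \<le>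
      ennreal (1 + (8 * A) powr q) * (\<integral>\<^sup>+x\<in>Q. \<phi> x (ennreal \<bar>h x\<bar>) \<partial>leb n)"
  proof (rule ennreal_le_of_scaled_bounds[OF le1])
    fix J :: real assume J: "0 < J" "J \<le> 1" "(\<integral>\<^sup>+x\<in>Q. \<phi> x (ennreal \<bar>h x\<bar>) \<partial>leb n) \<le> ennreal J"
    define c where "c = J powr (1 / q)"
    have c: "0 < c" "c powr q = J" using J q by (simp_all add: c_def powr_powr)
    have c1: "1 \<le> 1 / c" using J q c by (simp add: c_def powr_le1)
    have p_part: "(\<integral>\<^sup>+x\<in>Q. ennreal (1 / p * m powr p) \<partial>leb n) \<le> ennreal J"
    proof -
      have "(\<integral>\<^sup>+x\<in>Q. ennreal (1 / p * m powr p) \<partial>leb n) = ennreal (1 / p) * (ennreal (m powr p) * ennreal v)"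
        using p v by (simp add: nn_integral_cmult_indicator ennreal_mult[symmetric] mult.assoc)
      also have "\<dots> \<le> ennreal (1 / p) * (\<integral>\<^sup>+x\<in>Q. ennreal (\<bar>h x\<bar> powr p) \<partial>leb n)"
        using p by (intro mult_left_mono jensen_powr[OF h v m(2,1)]) auto
      also have "\<dots> = (\<integral>\<^sup>+x. ennreal (1 / p) * (ennreal (\<bar>h x\<bar> powr p) * indicator Q x) \<partial>leb n)"
        by (intro nn_integral_cmult[symmetric]) measurable
      also have "\<dots> \<le> (\<integral>\<^sup>+x\<in>Q. \<phi> x (ennreal \<bar>h x\<bar>) \<partial>leb n)"
      proof (intro nn_integral_mono)
        fix x assume x: "x \<in> space (leb n)"
        have "ennreal (1 / p) * ennreal (\<bar>h x\<bar> powr p) = ennreal (1 / p * \<bar>h x\<bar> powr p)"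
          using p by (intro ennreal_mult[symmetric]) auto
        also have "\<dots> \<le> \<phi> x (ennreal \<bar>h x\<bar>)"
          using a_nonneg[OF x] q by (simp add: phi_ennreal dp_def ennreal_leI)
        finally show "ennreal (1 / p) * (ennreal (\<bar>h x\<bar> powr p) * indicator Q x) \<le> \<phi> x (ennreal \<bar>h x\<bar>) * indicator Q x"
          by (simp add: indicator_def)
      qed
      also note J(3)
      finally show ?thesis .
    qed
    \<comment> \<open>\<open>1 / c \<ge> 1\<close> multiplies the modular by at most \<open>(1 / c) powr q = 1 / J\<close>; the term in \<open>q\<close> scales back by exactly \<open>J\<close>\<close>
    have q_part: "(\<integral>\<^sup>+x\<in>Q. ennreal (1 / q * a x * m powr q) \<partial>leb n) \<le> ennreal ((8 * A) powr q * J)"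
    proof -
      have "(\<integral>\<^sup>+x\<in>Q. \<phi> x (ennreal (\<bar>h x\<bar> / c)) \<partial>leb n) \<le>
          (\<integral>\<^sup>+x. ennreal (1 / J) * (\<phi> x (ennreal \<bar>h x\<bar>) * indicator Q x) \<partial>leb n)"
      proof (intro nn_integral_mono)
        fix x assume x: "x \<in> space (leb n)"
        have "dp (a x) (1 / c * \<bar>h x\<bar>) \<le> (1 / c) powr q * dp (a x) \<bar>h x\<bar>"
          using a_nonneg[OF x] c1 by (intro dp_scale_up) auto
        also have "(1 / c) powr q = 1 / J" using c by (simp add: powr_divide)
        finally have "\<phi> x (ennreal (\<bar>h x\<bar> / c)) \<le> ennreal (1 / J) * \<phi> x (ennreal \<bar>h x\<bar>)"
          using c J by (simp add: phi_ennreal ennreal_mult'[symmetric] ennreal_leI)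
        then show "\<phi> x (ennreal (\<bar>h x\<bar> / c)) * indicator Q x \<le> ennreal (1 / J) * (\<phi> x (ennreal \<bar>h x\<bar>) * indicator Q x)"
          by (simp add: indicator_def)
      qed
      also have "\<dots> = ennreal (1 / J) * (\<integral>\<^sup>+x\<in>Q. \<phi> x (ennreal \<bar>h x\<bar>) \<partial>leb n)"
        using measurable_comp[OF h] by (intro nn_integral_cmult) simp_all
      also have "\<dots> \<le> ennreal (1 / J) * ennreal J" by (intro mult_left_mono J) auto
      also have "\<dots> = 1" using J by (simp add: ennreal_mult'[symmetric])
      finally have le: "(\<integral>\<^sup>+x\<in>Q. \<phi> x (ennreal (m / (8 * A * c))) \<partial>leb n) \<le> 1"
        by (rule pair.scaled_mean_bound[OF Q A0 prod h m(2,1) c(1)])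
      have Ac: "0 < 8 * A * c" using A0 c by simp
      have "(\<integral>\<^sup>+x\<in>Q. ennreal (1 / q * a x * m powr q) \<partial>leb n) \<le>
          (\<integral>\<^sup>+x. ennreal ((8 * A) powr q * J) * (\<phi> x (ennreal (m / (8 * A * c))) * indicator Q x) \<partial>leb n)"
      proof (intro nn_integral_mono)
        fix x assume x: "x \<in> space (leb n)"
        define y where "y = m / (8 * A * c)"
        have y: "0 \<le> y" "m = (8 * A * c) * y" using m Ac A0 c by (simp_all add: y_def)
        have "m powr q = (8 * A * c) powr q * y powr q"
          unfolding y(2) by (rule powr_mult)
        also have "(8 * A * c) powr q = (8 * A) powr q * J" using A0 c by (simp add: powr_mult)
        finally have "1 / q * a x * m powr q = (8 * A) powr q * J * (1 / q * a x * y powr q)" by simp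
        also have "\<dots> \<le> (8 * A) powr q * J * dp (a x) y"
          using J p by (intro mult_left_mono) (auto simp: dp_def)
        finally have "ennreal (1 / q * a x * m powr q) \<le> ennreal ((8 * A) powr q * J) * \<phi> x (ennreal y)"
          using J y by (simp add: phi_ennreal ennreal_mult'[symmetric] ennreal_leI)
        then show "ennreal (1 / q * a x * m powr q) * indicator Q x \<le>
            ennreal ((8 * A) powr q * J) * (\<phi> x (ennreal (m / (8 * A * c))) * indicator Q x)"
          unfolding y_def by (simp add: indicator_def)
      qed
      also have "\<dots> = ennreal ((8 * A) powr q * J) * (\<integral>\<^sup>+x\<in>Q. \<phi> x (ennreal (m / (8 * A * c))) \<partial>leb n)"
        using measurable_const[of "m / (8 * A * c)"] m Ac by (intro nn_integral_cmult) simp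
      also have "\<dots> \<le> ennreal ((8 * A) powr q * J) * 1" by (intro mult_left_mono le) auto
      finally show ?thesis by simp
    qed
    have "(\<integral>\<^sup>+x\<in>Q. \<phi> x (ennreal m) \<partial>leb n) =
        (\<integral>\<^sup>+x\<in>Q. ennreal (1 / p * m powr p) \<partial>leb n) + (\<integral>\<^sup>+x\<in>Q. ennreal (1 / q * a x * m powr q) \<partial>leb n)"
    proof -
      have "(\<integral>\<^sup>+x\<in>Q. \<phi> x (ennreal m) \<partial>leb n) = (\<integral>\<^sup>+x. ennreal (1 / p * m powr p) * indicator Q x
          + ennreal (1 / q * a x * m powr q) * indicator Q x \<partial>leb n)"
      proof (intro nn_integral_cong)
        fix x assume x: "x \<in> space (leb n)"
        have "\<phi> x (ennreal m) = ennreal (1 / p * m powr p) + ennreal (1 / q * a x * m powr q)"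
          unfolding phi_ennreal[OF m(1)] dp_def using p q a_nonneg[OF x] by (intro ennreal_plus) auto
        then show "\<phi> x (ennreal m) * indicator Q x = ennreal (1 / p * m powr p) * indicator Q x
          + ennreal (1 / q * a x * m powr q) * indicator Q x" by (simp add: distrib_right)
      qed
      also have "\<dots> = (\<integral>\<^sup>+x\<in>Q. ennreal (1 / p * m powr p) \<partial>leb n) + (\<integral>\<^sup>+x\<in>Q. ennreal (1 / q * a x * m powr q) \<partial>leb n)"
        by (intro nn_integral_add) measurable
      finally show ?thesis .
    qed
    then have "(\<integral>\<^sup>+x\<in>Q. \<phi> x (ennreal m) \<partial>leb n) \<le> ennreal J + ennreal ((8 * A) powr q * J)"
      using p_part q_part by (simp only: add_mono)
    also have "\<dots> = ennreal (J + (8 * A) powr q * J)"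
      using J by (intro ennreal_plus[symmetric]) auto
    also have "J + (8 * A) powr q * J = (1 + (8 * A) powr q) * J" by (simp add: distrib_right)
    also have "ennreal \<dots> = ennreal (1 + (8 * A) powr q) * ennreal J"
      using J by (intro ennreal_mult) auto
    finally show "(\<integral>\<^sup>+x\<in>Q. \<phi> x (ennreal m) \<partial>leb n) \<le> ennreal (1 + (8 * A) powr q) * ennreal J" .
  qed (simp add: add_nonneg_nonneg)
  then show "\<exists>m\<ge>0. mean n Q h = ennreal m \<and> (\<integral>\<^sup>+x\<in>Q. \<phi> x (ennreal m) \<partial>leb n) \<le>
      ennreal (1 + (8 * A) powr q) * (\<integral>\<^sup>+x\<in>Q. \<phi> x (ennreal \<bar>h x\<bar>) \<partial>leb n)"
    using m by auto
qed auto

text \<open>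
  Rescaling alone does not suffice for \<open>h\<close>: enlarging the argument may raise the modular with the exponent
  \<open>p / (p - 1)\<close>, whereas reducing it is only sure to lower the modular with the smaller exponent
  \<open>q / (q - 1)\<close>.  On the set \<open>E\<close> the conjugate function of \<open>\<bar>h\<bar>\<close> is comparable to the unweighted
  power, and Jensen applies to the part \<open>f\<close>; on the part \<open>g\<close> both rescalings have the exponent
  \<open>q / (q - 1)\<close>.
\<close>
lemma conj_modular_mean_bound_if_A_const:
  assumes A: "A_const n \<phi> \<le> ennreal A" "1 \<le> A"
  shows "modular_mean_bound n \<phi>c (K_conj A)"
  unfolding K_conj_def
proof (rule conj.modular_mean_boundI)
  fix x and t :: real assume "x \<in> space (leb n)" "0 \<le> t"
  then show "\<phi>c x (ennreal (2 * t)) \<le> ennreal (equiv_const * 2 powr (1 + 1 / (p - 1))) * \<phi>c x (ennreal t)"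
    by (intro conj_scale_up) auto
next
  fix h Q assume h[measurable]: "h \<in> borel_measurable (leb n)" and Q: "Q \<in> cubes n"
    and le1: "(\<integral>\<^sup>+x\<in>Q. \<phi>c x (ennreal \<bar>h x\<bar>) \<partial>leb n) \<le> 1"
  let ?c = equiv_const and ?P = "1 / (p - 1)" and ?R = "1 / (q - 1)"
  define I where "I = (\<integral>\<^sup>+x\<in>Q. \<phi>c x (ennreal \<bar>h x\<bar>) \<partial>leb n)"
  \<comment> \<open>the factor lost when \<open>mean_bound\<close> is applied to \<open>g / (?c * k)\<close>, whose modular is at most one\<close>
  define L where "L = 8 * A * ?c"
  have c1: "1 \<le> ?c" by (rule equiv_const_ge_1)
  then have c0: "0 < ?c" by simp
  have A0: "0 < A" using A by simp
  have L1: "1 \<le> L"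
  proof -
    have "1 * 1 \<le> 8 * A * ?c" using A c1 by (intro mult_mono) auto
    then show ?thesis by (simp add: L_def)
  qed
  have prod: "lux_norm n \<phi>c (indicator Q) * lux_norm n \<phi> (indicator Q) / emeasure (leb n) Q \<le> ennreal A"
    using A_constD[OF A(1) Q] by (simp add: mult.commute)
  obtain v where v: "Q \<in> sets (leb n)" "0 < v" "emeasure (leb n) Q = ennreal v"
    using cubes_emeasure[OF Q] .
  have [measurable]: "Q \<in> sets (leb n)" by (rule v)
  obtain m where m: "0 \<le> m" "mean n Q h = ennreal m"
    using dual_pair.mean_bound[OF Q A0 prod h le1] by metis
  define E where "E = {x \<in> space (leb n). conj_slope (a x) \<bar>h x\<bar> = \<bar>h x\<bar> powr ?P}"
  have [measurable]: "E \<in> sets (leb n)" unfolding E_def by measurable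
  define f where "f x = h x * indicator E x" for x
  define g where "g x = h x * indicator (- E) x" for x
  have fm[measurable]: "f \<in> borel_measurable (leb n)" unfolding f_def by measurable
  have gm[measurable]: "g \<in> borel_measurable (leb n)"
  proof -
    have "(\<lambda>x. h x - f x) \<in> borel_measurable (leb n)" by measurable
    moreover have "g = (\<lambda>x. h x - f x)" by (auto simp: f_def g_def indicator_def)
    ultimately show ?thesis by simp
  qed
  have "mean n Q h = mean n Q f + mean n Q g"
    by (intro mean_add) (auto simp: f_def g_def indicator_def)
  with m have "mean n Q f + mean n Q g = ennreal m" by simp
  then obtain mf mg where mf: "0 \<le> mf" "mean n Q f = ennreal mf" and mg: "0 \<le> mg" "mean n Q g = ennreal mg"
    by (cases "mean n Q f"; cases "mean n Q g") auto
  have "m = mf + mg"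
    using \<open>mean n Q f + mean n Q g = ennreal m\<close> m mf mg by (simp add: ennreal_plus[symmetric] del: ennreal_plus)
  have f_bound: "(\<integral>\<^sup>+x\<in>Q. \<phi>c x (ennreal mf) \<partial>leb n) \<le> ennreal ?c * I"
  proof -
    have "(\<integral>\<^sup>+x\<in>Q. \<phi>c x (ennreal mf) \<partial>leb n) \<le> (\<integral>\<^sup>+x\<in>Q. ennreal (mf powr (1 + ?P)) \<partial>leb n)"
    proof (intro nn_integral_mono mult_right_mono)
      fix x assume x: "x \<in> space (leb n)"
      have "mf * conj_slope (a x) mf \<le> mf * mf powr ?P"
        using mf by (intro mult_left_mono) (auto simp: conj_slope_def)
      also have "\<dots> = mf powr (1 + ?P)" using mf by (cases "mf = 0") (simp_all add: powr_add)
      finally show "\<phi>c x (ennreal mf) \<le> ennreal (mf powr (1 + ?P))"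
        using conj_upper[OF x mf(1)] by (meson ennreal_leI order_trans)
    qed simp
    also have "\<dots> = ennreal (mf powr (1 + ?P)) * ennreal v" using v by (simp add: nn_integral_cmult_indicator)
    also have "\<dots> \<le> (\<integral>\<^sup>+x\<in>Q. ennreal (\<bar>f x\<bar> powr (1 + ?P)) \<partial>leb n)"
      using p by (intro jensen_powr[OF fm v mf(2,1)]) auto
    also have "\<dots> \<le> (\<integral>\<^sup>+x. ennreal ?c * (\<phi>c x (ennreal \<bar>h x\<bar>) * indicator Q x) \<partial>leb n)"
    proof (intro nn_integral_mono)
      fix x assume x: "x \<in> space (leb n)"
      have "ennreal (\<bar>f x\<bar> powr (1 + ?P)) \<le> ennreal ?c * \<phi>c x (ennreal \<bar>h x\<bar>)"
      proof (cases "x \<in> E")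
        case True
        then have "\<bar>f x\<bar> powr (1 + ?P) = \<bar>h x\<bar> * conj_slope (a x) \<bar>h x\<bar>"
          by (cases "h x = 0") (simp_all add: f_def E_def powr_add)
        then show ?thesis using conj_lower[OF x, of "\<bar>h x\<bar>"] by simp
      qed (simp add: f_def)
      then show "ennreal (\<bar>f x\<bar> powr (1 + ?P)) * indicator Q x \<le> ennreal ?c * (\<phi>c x (ennreal \<bar>h x\<bar>) * indicator Q x)"
        by (simp add: indicator_def)
    qed
    also have "\<dots> = ennreal ?c * I"
      unfolding I_def using conj.measurable_comp[OF h] by (intro nn_integral_cmult) simp_all
    finally show ?thesis .
  qed
  have g_bound: "(\<integral>\<^sup>+x\<in>Q. \<phi>c x (ennreal mg) \<partial>leb n) \<le> ennreal (?c * ?c * L powr (1 + ?P)) * I"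
    unfolding I_def
  proof (rule ennreal_le_of_scaled_bounds[OF le1])
    fix J :: real assume J: "0 < J" "J \<le> 1" "(\<integral>\<^sup>+x\<in>Q. \<phi>c x (ennreal \<bar>h x\<bar>) \<partial>leb n) \<le> ennreal J"
    \<comment> \<open>\<open>1 + ?R\<close> is the conjugate exponent of \<open>q\<close>\<close>
    define k where "k = J powr (1 / (1 + ?R))"
    have R: "0 < ?R" using q by simp
    have inv_mult: "1 / r * r = 1" if "0 < r" for r :: real using that by simp
    have k: "0 < k" "k \<le> 1" "k powr (1 + ?R) = J"
    proof -
      show "0 < k" "k \<le> 1" using J R by (simp_all add: k_def powr_le1)
      have "1 / (1 + ?R) * (1 + ?R) = 1" by (rule inv_mult) (use R in linarith)
      then show "k powr (1 + ?R) = J" unfolding k_def powr_powr using J by simp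
    qed
    have "(\<integral>\<^sup>+x\<in>Q. \<phi>c x (ennreal (\<bar>g x\<bar> / (?c * k))) \<partial>leb n) \<le>
        (\<integral>\<^sup>+x. ennreal (1 / J) * (\<phi>c x (ennreal \<bar>h x\<bar>) * indicator Q x) \<partial>leb n)"
    proof (intro nn_integral_mono)
      fix x assume x: "x \<in> space (leb n)"
      have "\<phi>c x (ennreal (\<bar>g x\<bar> / (?c * k))) \<le> ennreal (1 / J) * \<phi>c x (ennreal \<bar>h x\<bar>)"
      proof (cases "x \<in> E")
        case True
        then show ?thesis using conj.zero[OF x] by (simp add: g_def)
      next
        case False
        then have ne: "conj_slope (a x) \<bar>h x\<bar> \<noteq> \<bar>h x\<bar> powr ?P" using x by (simp add: E_def)
        \<comment> \<open>division by \<open>?c\<close> absorbs the loss from passing between the conjugate function and \<open>conj_slope\<close>\<close>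
        have "\<bar>g x\<bar> / (?c * k) = 1 / ?c * (1 / k * \<bar>h x\<bar>)" using False by (simp add: g_def)
        then have "\<phi>c x (ennreal (\<bar>g x\<bar> / (?c * k))) \<le> ennreal (1 / ?c) * \<phi>c x (ennreal (1 / k * \<bar>h x\<bar>))"
          using conj.scale[OF x, of "1 / ?c" "1 / k * \<bar>h x\<bar>"] c1 k by simp
        also have "\<dots> \<le> ennreal (1 / ?c) * (ennreal (?c * (1 / J)) * \<phi>c x (ennreal \<bar>h x\<bar>))"
        proof (intro mult_left_mono conj_le_of_slope_le[OF x])
          have "1 / k * \<bar>h x\<bar> * conj_slope (a x) (1 / k * \<bar>h x\<bar>)
              \<le> 1 / k * \<bar>h x\<bar> * ((1 / k) powr ?R * conj_slope (a x) \<bar>h x\<bar>)"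
            using k ne a_nonneg[OF x] by (intro mult_left_mono conj_slope_scale_up_weighted) auto
          also have "\<dots> = (1 / k * (1 / k) powr ?R) * (\<bar>h x\<bar> * conj_slope (a x) \<bar>h x\<bar>)" by simp
          also have "1 / k * (1 / k) powr ?R = (1 / k) powr (1 + ?R)" using k by (simp add: powr_add)
          also have "\<dots> = 1 / J" using k by (simp add: powr_divide)
          finally show "1 / k * \<bar>h x\<bar> * conj_slope (a x) (1 / k * \<bar>h x\<bar>)
              \<le> 1 / J * (\<bar>h x\<bar> * conj_slope (a x) \<bar>h x\<bar>)" .
        qed (use J k in auto)
        also have "\<dots> = ennreal (1 / ?c * (?c * (1 / J))) * \<phi>c x (ennreal \<bar>h x\<bar>)"
          using c0 J by (subst ennreal_mult[of "1 / ?c"]) (auto simp: mult.assoc)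
        also have "1 / ?c * (?c * (1 / J)) = 1 / J" using c0 by simp
        finally show ?thesis .
      qed
      then show "\<phi>c x (ennreal (\<bar>g x\<bar> / (?c * k))) * indicator Q x
          \<le> ennreal (1 / J) * (\<phi>c x (ennreal \<bar>h x\<bar>) * indicator Q x)"
        by (simp add: indicator_def)
    qed
    also have "\<dots> = ennreal (1 / J) * (\<integral>\<^sup>+x\<in>Q. \<phi>c x (ennreal \<bar>h x\<bar>) \<partial>leb n)"
      using conj.measurable_comp[OF h] by (intro nn_integral_cmult) simp_all
    also have "\<dots> \<le> ennreal (1 / J) * ennreal J" by (intro mult_left_mono J) auto
    also have "\<dots> = 1" using J by (simp add: ennreal_mult'[symmetric])
    finally have "(\<integral>\<^sup>+x\<in>Q. \<phi>c x (ennreal (mg / (8 * A * (?c * k)))) \<partial>leb n) \<le> 1"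
      using c0 k by (intro dual_pair.scaled_mean_bound[OF Q A0 prod gm mg(2,1)]) auto
    moreover define y where "y = mg / (8 * A * (?c * k))"
    ultimately have le: "(\<integral>\<^sup>+x\<in>Q. \<phi>c x (ennreal y) \<partial>leb n) \<le> 1" by simp
    have y: "0 \<le> y" "mg = L * (k * y)" using mg A0 c0 k by (simp_all add: y_def L_def)
    let ?K = "?c * ?c * L powr (1 + ?P)"
    have "(\<integral>\<^sup>+x\<in>Q. \<phi>c x (ennreal mg) \<partial>leb n) \<le>
        (\<integral>\<^sup>+x. ennreal (?K * J) * (\<phi>c x (ennreal y) * indicator Q x) \<partial>leb n)"
    proof (intro nn_integral_mono)
      fix x assume x: "x \<in> space (leb n)"
      have "\<phi>c x (ennreal mg) \<le> ennreal (?c * L powr (1 + ?P)) * \<phi>c x (ennreal (k * y))"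
        unfolding y(2) using x y k L1 by (intro conj_scale_up) auto
      also have "\<dots> \<le> ennreal (?c * L powr (1 + ?P)) * (ennreal (?c * J) * \<phi>c x (ennreal y))"
        using conj_scale_down[OF x y(1) k(1,2)] k(3) by (intro mult_left_mono) auto
      also have "\<dots> = ennreal (?c * L powr (1 + ?P) * (?c * J)) * \<phi>c x (ennreal y)"
        using c0 J by (subst ennreal_mult[of "?c * L powr (1 + ?P)"]) (auto simp: mult.assoc)
      also have "?c * L powr (1 + ?P) * (?c * J) = ?K * J" by simp
      finally show "\<phi>c x (ennreal mg) * indicator Q x \<le> ennreal (?K * J) * (\<phi>c x (ennreal y) * indicator Q x)"
        by (simp add: indicator_def)
    qed
    also have "\<dots> = ennreal (?K * J) * (\<integral>\<^sup>+x\<in>Q. \<phi>c x (ennreal y) \<partial>leb n)"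
      using conj.measurable_const[OF y(1)] by (intro nn_integral_cmult) simp_all
    also have "\<dots> \<le> ennreal (?K * J) * 1" by (intro mult_left_mono le) auto
    also have "\<dots> = ennreal ?K * ennreal J" using c0 J by (subst ennreal_mult) auto
    finally show "(\<integral>\<^sup>+x\<in>Q. \<phi>c x (ennreal mg) \<partial>leb n) \<le> ennreal ?K * ennreal J" .
  qed (use c0 in auto)
  let ?D = "?c * 2 powr (1 + ?P)" and ?K = "?c * ?c * L powr (1 + ?P)"
  show "\<exists>m\<ge>0. mean n Q h = ennreal m \<and> (\<integral>\<^sup>+x\<in>Q. \<phi>c x (ennreal m) \<partial>leb n) \<le>
      ennreal (?D * (?c + ?c * ?c * (8 * A * ?c) powr (1 + ?P))) * (\<integral>\<^sup>+x\<in>Q. \<phi>c x (ennreal \<bar>h x\<bar>) \<partial>leb n)"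
  proof (intro exI conjI)
    have "(\<integral>\<^sup>+x\<in>Q. \<phi>c x (ennreal m) \<partial>leb n) \<le> (\<integral>\<^sup>+x. ennreal ?D *
        (\<phi>c x (ennreal mf) * indicator Q x + \<phi>c x (ennreal mg) * indicator Q x) \<partial>leb n)"
    proof (intro nn_integral_mono)
      fix x assume x: "x \<in> space (leb n)"
      have "\<phi>c x (ennreal m) \<le> \<phi>c x (ennreal (2 * max mf mg))"
        using x mf mg by (intro conj.mono ennreal_leI) (auto simp: \<open>m = mf + mg\<close>)
      also have "\<dots> \<le> ennreal ?D * \<phi>c x (ennreal (max mf mg))"
        using x mf by (intro conj_scale_up) auto
      also have "\<phi>c x (ennreal (max mf mg)) \<le> \<phi>c x (ennreal mf) + \<phi>c x (ennreal mg)"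
        by (simp add: max_def add_increasing add_increasing2)
      finally have "\<phi>c x (ennreal m) \<le> ennreal ?D * (\<phi>c x (ennreal mf) + \<phi>c x (ennreal mg))"
        by (simp add: mult_left_mono)
      then show "\<phi>c x (ennreal m) * indicator Q x \<le> ennreal ?D *
          (\<phi>c x (ennreal mf) * indicator Q x + \<phi>c x (ennreal mg) * indicator Q x)"
        by (simp add: indicator_def)
    qed
    also have "\<dots> = ennreal ?D * (\<integral>\<^sup>+x. \<phi>c x (ennreal mf) * indicator Q x + \<phi>c x (ennreal mg) * indicator Q x \<partial>leb n)"
      using conj.measurable_const[OF mf(1)] conj.measurable_const[OF mg(1)] by (intro nn_integral_cmult) simp_all
    also have "(\<integral>\<^sup>+x. \<phi>c x (ennreal mf) * indicator Q x + \<phi>c x (ennreal mg) * indicator Q x \<partial>leb n) =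
        (\<integral>\<^sup>+x\<in>Q. \<phi>c x (ennreal mf) \<partial>leb n) + (\<integral>\<^sup>+x\<in>Q. \<phi>c x (ennreal mg) \<partial>leb n)"
      using conj.measurable_const[OF mf(1)] conj.measurable_const[OF mg(1)] by (intro nn_integral_add) simp_all
    also have "ennreal ?D * \<dots> \<le> ennreal ?D * (ennreal ?c * I + ennreal ?K * I)"
      by (intro mult_left_mono add_mono f_bound g_bound) simp
    also have "\<dots> = ennreal (?D * (?c + ?K)) * I"
    proof -
      have "ennreal ?c * I + ennreal ?K * I = ennreal (?c + ?K) * I"
        using c0 by (subst ennreal_plus) (auto simp: distrib_right)
      then show ?thesis using c0 by (subst ennreal_mult) (auto simp: mult.assoc)
    qed
    finally show "(\<integral>\<^sup>+x\<in>Q. \<phi>c x (ennreal m) \<partial>leb n) \<le>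
        ennreal (?D * (?c + ?c * ?c * (8 * A * ?c) powr (1 + ?P))) * (\<integral>\<^sup>+x\<in>Q. \<phi>c x (ennreal \<bar>h x\<bar>) \<partial>leb n)"
      unfolding L_def I_def .
  qed (use m in auto)
qed (use equiv_const_ge_1 in auto)

end

section \<open>One constant for all implications\<close>

lemma modular_mean_bound_weaken:
  assumes "modular_mean_bound n \<Phi> C" "C \<le> C'"
  shows "modular_mean_bound n \<Phi> C'"
  unfolding modular_mean_bound_def
proof (intro ballI impI)
  fix f Q assume "f \<in> L_space n \<Phi>" "lux_norm n \<Phi> f \<le> 1" "Q \<in> cubes n"
  then have "(\<integral>\<^sup>+x\<in>Q. \<Phi> x (mean n Q f) \<partial>leb n) \<le> ennreal C * (\<integral>\<^sup>+x\<in>Q. \<Phi> x (ennreal \<bar>f x\<bar>) \<partial>leb n)"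
    using assms(1) by (simp add: modular_mean_bound_def)
  also have "\<dots> \<le> ennreal C' * (\<integral>\<^sup>+x\<in>Q. \<Phi> x (ennreal \<bar>f x\<bar>) \<partial>leb n)"
    by (intro mult_right_mono ennreal_leI assms(2)) simp
  finally show "(\<integral>\<^sup>+x\<in>Q. \<Phi> x (mean n Q f) \<partial>leb n) \<le> ennreal C' * (\<integral>\<^sup>+x\<in>Q. \<Phi> x (ennreal \<bar>f x\<bar>) \<partial>leb n)" .
qed

context exponents begin

lemma K_phi_nonneg: "0 \<le> K_phi A"
  by (simp add: K_phi_def add_nonneg_nonneg)

lemma K_conj_nonneg: "0 \<le> K_conj A"
  unfolding K_conj_def using equiv_const_ge_1
  by (intro mult_nonneg_nonneg add_nonneg_nonneg) auto

text \<open>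
  Each of the three hypotheses with constant \<open>C\<close> bounds the class constant by \<open>2 * (C + 1)\<close>, from
  which everything else follows.
\<close>
definition K_all :: "real \<Rightarrow> real" where
  "K_all C = 2 * (C + 1) + K_phi (2 * (C + 1)) + K_conj (2 * (C + 1))"

lemma K_all_pos: "0 < C \<Longrightarrow> 0 < K_all C"
  using K_phi_nonneg[of "2 * (C + 1)"] K_conj_nonneg[of "2 * (C + 1)"] by (simp add: K_all_def)

end

context double_phase_setting begin

lemma all_from_A_const:
  assumes "0 < C" "A_const n \<phi> \<le> ennreal (2 * (C + 1))"
  shows "A_const n \<phi> \<le> ennreal (K_all C)" "modular_mean_bound n \<phi> (K_all C)"
    "modular_mean_bound n \<phi>c (K_all C)"
proof -
  have le: "2 * (C + 1) \<le> K_all C" "K_phi (2 * (C + 1)) \<le> K_all C" "K_conj (2 * (C + 1)) \<le> K_all C"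
    using assms(1) K_phi_nonneg[of "2 * (C + 1)"] K_conj_nonneg[of "2 * (C + 1)"]
    by (simp_all add: K_all_def)
  show "A_const n \<phi> \<le> ennreal (K_all C)"
    using assms(2) ennreal_leI[OF le(1)] by (rule order_trans)
  show "modular_mean_bound n \<phi> (K_all C)"
    using phi_modular_mean_bound_if_A_const[OF assms(2)] assms(1)
    by (intro modular_mean_bound_weaken[OF _ le(2)]) simp
  show "modular_mean_bound n \<phi>c (K_all C)"
    using conj_modular_mean_bound_if_A_const[OF assms(2)] assms(1)
    by (intro modular_mean_bound_weaken[OF _ le(3)]) simp
qed

lemma quantitative_equivalence:
  assumes C: "0 < C"
    and "A_const n \<phi> \<le> ennreal C \<or> modular_mean_bound n \<phi> C \<or> modular_mean_bound n \<phi>c C"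
  shows "A_const n \<phi> \<le> ennreal (K_all C)" "modular_mean_bound n \<phi> (K_all C)"
    "modular_mean_bound n \<phi>c (K_all C)"
proof -
  have "A_const n \<phi> \<le> ennreal (2 * (C + 1))" if "A_const n \<phi> \<le> ennreal C"
    using C by (intro order_trans[OF that] ennreal_leI) simp
  then have "A_const n \<phi> \<le> ennreal (2 * (C + 1))"
    using assms(2) A_const_if_modular_mean_bound[OF _ C] A_const_if_conj_modular_mean_bound[OF _ C]
    by blast
  then show "A_const n \<phi> \<le> ennreal (K_all C)" "modular_mean_bound n \<phi> (K_all C)"
    "modular_mean_bound n \<phi>c (K_all C)"
    by (rule all_from_A_const[OF C])+
qed

lemma class_A_iff: "\<phi> \<in> class_A n \<longleftrightarrow> (\<exists>C>0. A_const n \<phi> \<le> ennreal C)"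
proof
  assume "\<phi> \<in> class_A n"
  then obtain c where c: "A_const n \<phi> = ennreal c" "0 \<le> c"
    by (cases "A_const n \<phi>") (auto simp: class_A_def)
  then have "A_const n \<phi> \<le> ennreal (c + 1)" by (simp add: ennreal_leI)
  then show "\<exists>C>0. A_const n \<phi> \<le> ennreal C"
    using c(2) by (intro exI[of _ "c + 1"]) simp
next
  assume "\<exists>C>0. A_const n \<phi> \<le> ennreal C"
  then obtain C where "A_const n \<phi> \<le> ennreal C" by blast
  then have "A_const n \<phi> < \<infinity>" by (rule le_less_trans) simp
  then show "\<phi> \<in> class_A n" by (simp add: class_A_def)
qed

lemma qualitative_equivalence:
  "\<phi> \<in> class_A n \<longleftrightarrow> (\<exists>C>0. modular_mean_bound n \<phi> C)"
  "\<phi> \<in> class_A n \<longleftrightarrow> (\<exists>C>0. modular_mean_bound n \<phi>c C)"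
  unfolding class_A_iff using quantitative_equivalence K_all_pos by blast+

end

theorem theorem2p5:
  fixes p q :: real
  assumes "1 < p" and "p < q"
  shows
    "(\<forall>n\<ge>1. \<forall>a\<in>borel_measurable (leb n). (\<forall>x\<in>space (leb n). 0 \<le> a x) \<longrightarrow>
        (let \<phi> = double_phase p q a in
          (\<phi> \<in> class_A n \<longleftrightarrow> (\<exists>C>0. modular_mean_bound n \<phi> C)) \<and>
          (\<phi> \<in> class_A n \<longleftrightarrow> (\<exists>C>0. modular_mean_bound n (conjugate \<phi>) C)))) \<and>
     (\<exists>K :: real \<Rightarrow> real. (\<forall>C>0. 0 < K C) \<and>
        (\<forall>n\<ge>1. \<forall>a\<in>borel_measurable (leb n). (\<forall>x\<in>space (leb n). 0 \<le> a x) \<longrightarrow>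
          (let \<phi> = double_phase p q a in
            \<forall>C>0.
              (A_const n \<phi> \<le> ennreal C \<longrightarrow>
                 modular_mean_bound n \<phi> (K C) \<and> modular_mean_bound n (conjugate \<phi>) (K C)) \<and>
              (modular_mean_bound n \<phi> C \<longrightarrow>
                 A_const n \<phi> \<le> ennreal (K C) \<and> modular_mean_bound n (conjugate \<phi>) (K C)) \<and>
              (modular_mean_bound n (conjugate \<phi>) C \<longrightarrow>
                 A_const n \<phi> \<le> ennreal (K C) \<and> modular_mean_bound n \<phi> (K C)))))"
proof -
  interpret exponents p q using assms by unfold_locales
  have setting: "double_phase_setting p q n a"
    if "a \<in> borel_measurable (leb n)" "\<forall>x\<in>space (leb n). 0 \<le> a x" for n a
    using that by unfold_locales auto
  show ?thesis
  proof (intro conjI exI[of _ K_all] allI ballI impI, goal_cases)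
    case (1 n a)
    then interpret double_phase_setting p q n a by (intro setting)
    show ?case unfolding Let_def using qualitative_equivalence by (intro conjI)
  next
    case (2 C)
    then show ?case by (rule K_all_pos)
  next
    case (3 n a)
    then interpret double_phase_setting p q n a by (intro setting)
    show ?case unfolding Let_def using quantitative_equivalence by blast
  qed
qed

end
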